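(* For any $d,n\in\mathbb{N}$ and $C,\alpha,D>0$ there exists $\varepsilon_0=\varepsilon_0(d,n,C,\alpha,D)\in(0,1]$ with the following property. Let $\nu$ be a measure on $\mathbb{R}^d$, let $U\subset\mathbb{R}^d$ be open with $\nu(U)>0$, and let $\mathbf{f}:U\to\mathbb{R}^n$ be a continuous map. Assume that $\nu$ is $D$-Federer, and that $(\mathbf{f},\nu)$ is $(C,\alpha)$-good and nonplanar. Then for any $\varepsilon$ with $0<\varepsilon<\varepsilon_0$, $$\mathbf{f}_*\nu\big(\mathrm{DI}_\varepsilon(\mathcal{T})\big)=0\quad\text{for any unbounded }\mathcal{T}\subset\mathfrak{a}^+,$$ that is, $\nu\big(\{\mathbf{x}\in U:\mathbf{f}(\mathbf{x})\in\mathrm{DI}_\varepsilon(\mathcal{T})\}\big)=0$ for every unbounded $\mathcal{T}\subset\mathfrak{a}^+$.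
   Context: All measures on Euclidean spaces are Radon (locally finite regular Borel). $B(\mathbf{x},r)$ is the open ball in $\mathbb{R}^d$ (Euclidean distance), and for $B=B(\mathbf{x},r)$ and $c>0$, $cB=B(\mathbf{x},cr)$. Diophantine notions. $\mathbb{R}^n$ is identified with the space $M_{1,n}$ of row vectors. Let $\mathfrak{a}^+$ be the set of $\mathbf{t}=(t_1,\dots,t_{n+1})\in\mathbb{R}^{n+1}$ with all $t_i>0$ and $t_1=\sum_{j=1}^n t_{1+j}$; write $\|\mathbf{t}\|=\max_i|t_i|$. For unbounded $\mathcal{T}\subset\mathfrak{a}^+$ and $0<\varepsilon<1$, $\mathrm{DI}_\varepsilon(\mathcal{T})$ is the set of $\mathbf{y}\in\mathbb{R}^n$ for which there is $t_0$ such that for every $\mathbf{t}\in\mathcal{T}$ with $\|\mathbf{t}\|>t_0$ there exist $\mathbf{q}\in\mathbb{Z}^n\smallsetminus\{0\}$ and $p\in\mathbb{Z}$ with $|y_1q_1+\dots+y_nq_n-p|<\varepsilon e^{-t_1}$ and $|q_j|<\varepsilon e^{t_{1+j}}$ for $j=1,\dots,n$. Measure-theoretic notions. A measure $\nu$ on $\mathbb{R}^d$ is $D$-Federer on an open set $V\subset\mathbb{R}^d$ if $\nu(3B)/\nu(B)\le D$ for all balls $B$ centered at points of $\operatorname{supp}\nu$ with $3B\subset V$. It is $D$-Federer if for $\nu$-a.e. $\mathbf{x}\in\mathbb{R}^d$ there is a neighborhood $V$ of $\mathbf{x}$ such that $\nu$ is $D$-Federer on $V$. For $B\subset\mathbb{R}^d$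 with $\nu(B)>0$ and a real-valued measurable $f$ on $B$, put $\|f\|_{\nu,B}=\sup_{\mathbf{x}\in B\cap\operatorname{supp}\nu}|f(\mathbf{x})|$. A function $f:V\to\mathbb{R}$ is $(C,\alpha)$-good on an open set $V$ with respect to $\nu$ if for any ball $B\subset V$ centered in $\operatorname{supp}\nu$ and any $\eta>0$, $$\nu\big(\{\mathbf{y}\in B:|f(\mathbf{y})|<\eta\}\big)\le C\left(\frac{\eta}{\|f\|_{\nu,B}}\right)^{\alpha}\nu(B)$$ (the right-hand side being $+\infty$ if $\|f\|_{\nu,B}=0$). For $\mathbf{f}=(f_1,\dots,f_n)$, the pair $(\mathbf{f},\nu)$ is $(C,\alpha)$-good on $V$ if every linear combination of $1,f_1,\dots,f_n$ is $(C,\alpha)$-good on $V$ with respect to $\nu$. It is nonplanar on $V$ if for any ball $B\subset V$ centered in $\operatorname{supp}\nu$, the restrictions of $1,f_1,\dots,f_n$ to $B\cap\operatorname{supp}\nu$ are linearly independent over $\mathbb{R}$. For $\mathbf{f}$ defined on $U$, $(\mathbf{f},\nu)$ is $(C,\alpha)$-good (resp. nonplanar) if for $\nu$-a.e. $\mathbf{x}\in U$ there is a neighborhood $V\subset U$ of $\mathbf{x}$ such that $(\mathbf{f},\nu)$ is $(C,\alpha)$-good (resp. nonplanar) on $V$. *)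

theory Defs
  imports "HOL-Analysis.Analysis"
begin

section \<open>Measures on Euclidean space\<close>

definition radon_measure :: "'a::euclidean_space measure \<Rightarrow> bool" where
  "radon_measure \<nu> \<longleftrightarrow>
     sets \<nu> = sets borel \<and>
     (\<forall>x. \<exists>V. open V \<and> x \<in> V \<and> emeasure \<nu> V < \<infinity>) \<and>
     (\<forall>A\<in>sets borel. emeasure \<nu> A = (SUP K\<in>{K. K \<subseteq> A \<and> compact K}. emeasure \<nu> K)) \<and>
     (\<forall>A\<in>sets borel. emeasure \<nu> A = (INF W\<in>{W. A \<subseteq> W \<and> open W}. emeasure \<nu> W))"

definition msupp :: "'a::topological_space measure \<Rightarrow> 'a set" where
  "msupp \<nu> = {x. \<forall>V. open V \<and> x \<in> V \<longrightarrow> 0 < emeasure \<nu> V}"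

text \<open>The ball \<open>B\<close> is given by its centre and radius, so that \<open>3B\<close> is \<open>ball x (3 * r)\<close>.\<close>

definition Federer_on :: "real \<Rightarrow> 'a::euclidean_space measure \<Rightarrow> 'a set \<Rightarrow> bool" where
  "Federer_on D \<nu> V \<longleftrightarrow>
     (\<forall>x\<in>msupp \<nu>. \<forall>r>0. ball x (3 * r) \<subseteq> V \<longrightarrow>
        emeasure \<nu> (ball x (3 * r)) / emeasure \<nu> (ball x r) \<le> ennreal D)"

definition Federer :: "real \<Rightarrow> 'a::euclidean_space measure \<Rightarrow> bool" where
  "Federer D \<nu> \<longleftrightarrow> (AE x in \<nu>. \<exists>V. open V \<and> x \<in> V \<and> Federer_on D \<nu> V)"


section \<open>Good functions and nonplanarity\<close>

text \<open>The supremum is taken in \<open>[0, \<infinity>]\<close>: a function that is merely continuous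
  on an open set may be unbounded on a ball contained in that set.\<close>

definition supnorm :: "'a::euclidean_space measure \<Rightarrow> 'a set \<Rightarrow> ('a \<Rightarrow> real) \<Rightarrow> ennreal" where
  "supnorm \<nu> B f = (SUP x\<in>B \<inter> msupp \<nu>. ennreal \<bar>f x\<bar>)"

text \<open>The value of \<open>C * (\<eta> / N) powr \<alpha>\<close> in \<open>[0, \<infinity>]\<close> for \<open>\<alpha> > 0\<close>: it is \<open>\<infinity>\<close> for \<open>N = 0\<close>,
  and it is \<open>0\<close> for \<open>N = \<infinity>\<close>, because then \<open>\<eta> / N = 0\<close>.\<close>

definition good_factor :: "real \<Rightarrow> real \<Rightarrow> real \<Rightarrow> ennreal \<Rightarrow> ennreal" where
  "good_factor C \<alpha> \<eta> N =
     (if N = 0 then \<infinity> else ennreal (C * enn2real (ennreal \<eta> / N) powr \<alpha>))"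

text \<open>The sublevel sets below are Borel when \<open>f\<close> is continuous on \<open>V\<close>, the case of interest.\<close>

definition good_fun_on ::
  "real \<Rightarrow> real \<Rightarrow> 'a::euclidean_space measure \<Rightarrow> 'a set \<Rightarrow> ('a \<Rightarrow> real) \<Rightarrow> bool" where
  "good_fun_on C \<alpha> \<nu> V f \<longleftrightarrow>
     (\<forall>x\<in>msupp \<nu>. \<forall>r>0. ball x r \<subseteq> V \<longrightarrow> (\<forall>\<eta>>0.
        emeasure \<nu> {y \<in> ball x r. \<bar>f y\<bar> < \<eta>}
          \<le> good_factor C \<alpha> \<eta> (supnorm \<nu> (ball x r) f) * emeasure \<nu> (ball x r)))"

definition good_on ::
  "real \<Rightarrow> real \<Rightarrow> 'a::euclidean_space measure \<Rightarrow> 'a set \<Rightarrow> ('a \<Rightarrow> real ^ 'n) \<Rightarrow> bool" where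
  "good_on C \<alpha> \<nu> V f \<longleftrightarrow>
     (\<forall>(c0::real) (c::real ^ 'n). good_fun_on C \<alpha> \<nu> V (\<lambda>x. c0 + (\<Sum>i\<in>UNIV. c $ i * f x $ i)))"

definition good ::
  "real \<Rightarrow> real \<Rightarrow> 'a::euclidean_space measure \<Rightarrow> 'a set \<Rightarrow> ('a \<Rightarrow> real ^ 'n) \<Rightarrow> bool" where
  "good C \<alpha> \<nu> U f \<longleftrightarrow>
     (AE x in \<nu>. x \<in> U \<longrightarrow> (\<exists>V\<subseteq>U. open V \<and> x \<in> V \<and> good_on C \<alpha> \<nu> V f))"

text \<open>Linear independence of the family \<open>1, f\<^sub>1, \<dots>, f\<^sub>n\<close>, restricted to \<open>B \<inter> msupp \<nu>\<close>:
  only the trivial linear combination vanishes there.\<close>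

definition nonplanar_on ::
  "'a::euclidean_space measure \<Rightarrow> 'a set \<Rightarrow> ('a \<Rightarrow> real ^ 'n) \<Rightarrow> bool" where
  "nonplanar_on \<nu> V f \<longleftrightarrow>
     (\<forall>x\<in>msupp \<nu>. \<forall>r>0. ball x r \<subseteq> V \<longrightarrow>
        (\<forall>(c0::real) (c::real ^ 'n).
           (\<forall>y\<in>ball x r \<inter> msupp \<nu>. c0 + (\<Sum>i\<in>UNIV. c $ i * f y $ i) = 0)
             \<longrightarrow> c0 = 0 \<and> (\<forall>i. c $ i = 0)))"

definition nonplanar ::
  "'a::euclidean_space measure \<Rightarrow> 'a set \<Rightarrow> ('a \<Rightarrow> real ^ 'n) \<Rightarrow> bool" where
  "nonplanar \<nu> U f \<longleftrightarrow>
     (AE x in \<nu>. x \<in> U \<longrightarrow> (\<exists>V\<subseteq>U. open V \<and> x \<in> V \<and> nonplanar_on \<nu> V f))"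


section \<open>Vectors improvable by Dirichlet's theorem\<close>

text \<open>The space \<open>\<real>\<^sup>n\<^sup>+\<^sup>1\<close> is \<open>real ^ ('n option)\<close>: the coordinate \<open>t\<^sub>1\<close> is \<open>t $ None\<close>, and
  \<open>t\<^sub>1\<^sub>+\<^sub>j\<close> is \<open>t $ Some j\<close>. The library norm \<^const>\<open>infnorm\<close> is the maximum of the \<open>\<bar>t\<^sub>i\<bar>\<close>.\<close>

definition a_plus :: "(real ^ ('n::finite option)) set" where
  "a_plus = {t. (\<forall>i. 0 < t $ i) \<and> t $ None = (\<Sum>j\<in>UNIV. t $ Some j)}"

definition DI :: "real \<Rightarrow> (real ^ ('n::finite option)) set \<Rightarrow> (real ^ 'n) set" where
  "DI \<epsilon> T = {y. \<exists>t0::real. \<forall>t\<in>T. infnorm t > t0 \<longrightarrow>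
     (\<exists>(q::int ^ 'n) (p::int). q \<noteq> 0 \<and>
        \<bar>(\<Sum>j\<in>UNIV. y $ j * of_int (q $ j)) - of_int p\<bar> < \<epsilon> * exp (- (t $ None)) \<and>
        (\<forall>j. \<bar>of_int (q $ j)\<bar> < \<epsilon> * exp (t $ Some j)))}"

end

theory Submission
  imports Defs
begin

text \<open>
  For \<open>t\<close> in \<open>a_plus\<close> and \<open>y\<close> in \<open>\<real>\<^sup>n\<close>, shear the lattice \<open>\<int>\<^sup>n\<^sup>+\<^sup>1\<close> by \<open>(p, q) \<mapsto> (p + y \<bullet> q, q)\<close>, then
  stretch the first coordinate by \<open>exp t\<^sub>1\<close> and contract the others by \<open>exp (- t\<^sub>1\<^sub>+\<^sub>j)\<close>. For
  \<open>\<epsilon> \<le> 1\<close>, solvability of the Diophantine system for \<open>t\<close> and \<open>\<epsilon>\<close> amounts to the existence of a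
  nonzero vector of this unimodular lattice of maximum norm below \<open>\<epsilon>\<close>. The theorem holds because, for
  \<open>y = f x\<close>, such lattices are rare on every small scale: on each small ball \<open>B\<close> centred in the support of \<open>\<nu>\<close>, and for every \<open>t\<close> that is large enough
  depending on \<open>B\<close>, the set of \<open>x\<close> in \<open>B\<close> whose lattice has a vector shorter than \<open>\<epsilon>\<close> has measure at most
  \<open>const \<cdot> \<epsilon> powr \<alpha> \<cdot> \<nu> B\<close>, with a constant that depends only on \<open>n, C, \<alpha>, D\<close>
  (\<open>short_vector_measure\<close>). Choose \<open>\<epsilon>0\<close> such that this is at most half of \<open>\<nu> B\<close>. A point \<open>x\<close> with \<open>f x\<close> in
  \<open>DI \<epsilon> T\<close> lies in these sets for all large \<open>t\<close> in \<open>T\<close>, so the points improvable from a fixed stage on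
  fill at most half of every small ball. A set that is so thin around each of its own points is null
  (\<open>null_of_no_density\<close>), and countably many stages suffice.

  The measure estimate is the quantitative nondivergence theorem of Kleinbock and Margulis. To each nonzero
  rational subspace \<open>L\<close> belongs a covolume \<open>covol t L y\<close> of the deformed lattice points of \<open>L\<close>. Its
  properties are the following. It is a maximum of absolute values of affine functions of \<open>y\<close>, so composing it with \<open>f\<close>
  gives a good function (\<open>good_covol\<close>). If the deformed \<open>v\<close> is short, then passing from \<open>M\<close> to the span of
  \<open>M\<close> and \<open>v\<close> makes the covolume small compared with that of \<open>M\<close> (\<open>covol_extend\<close>). Nonplanarity forces
  the covolume of every \<open>L\<close> to reach \<open>1\<close> somewhere on the ball once \<open>t\<close> is large
  (\<open>covol_lower_bound\<close>). Moreover, the length of a chain of subspaces is at most \<open>n + 1\<close>. From this,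
  \<open>quantitative_nondivergence\<close> finds, outside a small set, a chain of subspaces whose covolumes lie between
  a multiple of \<open>\<epsilon>\<close> and \<open>1\<close>, such that every other subspace comparable with the whole chain has covolume
  at least \<open>1\<close>; such a chain excludes short vectors (\<open>marked_imp_no_short_vector\<close>).

  Exterior powers are replaced by determinants: the coordinates of \<open>v\<^sub>1 \<and> \<dots> \<and> v\<^sub>j\<close> are the determinants
  of the square matrices that have \<open>v\<^sub>1, \<dots>, v\<^sub>j\<close> among their rows and vectors of a fixed basis as the other
  rows. Bases of the groups \<open>L \<inter> \<int>\<^sup>n\<^sup>+\<^sup>1\<close> are replaced by integer frames with minimal determinants.
\<close>

section \<open>Quantitative nondivergence\<close>

text \<open>
  With \<open>\<phi> s\<close> the value of the \<open>s\<close>-th function at a point, this says that the point admits a clique of \<open>R\<close> on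
  which \<open>\<phi>\<close> takes values between \<open>\<epsilon>\<close> and \<open>1\<close>, while \<open>\<phi>\<close> is at least \<open>1\<close> at every other index that is
  related to the whole clique. The clique is built one index at a time because the induction in the
  nondivergence theorem replaces \<open>P\<close> by the neighbours of one index.
\<close>

inductive marked :: "('s \<Rightarrow> 's \<Rightarrow> bool) \<Rightarrow> real \<Rightarrow> ('s \<Rightarrow> real) \<Rightarrow> 's set \<Rightarrow> bool"
  for R :: "'s \<Rightarrow> 's \<Rightarrow> bool" and \<epsilon> :: real and \<phi> :: "'s \<Rightarrow> real" where
  large: "(\<And>s. s \<in> P \<Longrightarrow> 1 \<le> \<phi> s) \<Longrightarrow> marked R \<epsilon> \<phi> P"
| small: "s \<in> P \<Longrightarrow> \<epsilon> \<le> \<phi> s \<Longrightarrow> \<phi> s \<le> 1 \<Longrightarrow> marked R \<epsilon> \<phi> {t \<in> P. R s t} \<Longrightarrow> marked R \<epsilon> \<phi> P"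

definition cliques_le :: "('s \<Rightarrow> 's \<Rightarrow> bool) \<Rightarrow> nat \<Rightarrow> 's set \<Rightarrow> bool" where
  "cliques_le R m P \<longleftrightarrow> (\<forall>F\<subseteq>P. finite F \<and> pairwise R F \<longrightarrow> card F \<le> m)"

lemma cliques_le_0: "cliques_le R 0 P \<Longrightarrow> P = {}"
proof (rule ccontr)
  assume c: "cliques_le R 0 P" and "P \<noteq> {}"
  then obtain s where "s \<in> P" by blast
  with c[unfolded cliques_le_def, rule_format, of "{s}"] show False by (simp add: pairwise_def)
qed

lemma cliques_le_neighbours:
  assumes "symp R" "irreflp R" "cliques_le R (Suc m) P" "s \<in> P"
  shows "cliques_le R m {t \<in> P. R s t}"
  unfolding cliques_le_def
proof (intro allI impI)
  fix F assume F: "F \<subseteq> {t \<in> P. R s t}" "finite F \<and> pairwise R F"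
  have "pairwise R (insert s F)"
    using F assms(1) by (auto simp: pairwise_insert dest: sympD)
  moreover have "s \<notin> F" using F assms(2) by (auto dest: irreflpD)
  ultimately show "card F \<le> m"
    using assms(3)[unfolded cliques_le_def, rule_format, of "insert s F"] F assms(4) by auto
qed

text \<open>
  The quotient causes no trouble: a ball centred in the support has positive measure, and the claim is
  trivial if its measure is infinite.
\<close>

lemma Federer_onD:
  assumes "Federer_on D \<nu> V" "D > 0" "x \<in> msupp \<nu>" "r > 0" "ball x (3 * r) \<subseteq> V"
  shows "emeasure \<nu> (ball x (3 * r)) \<le> ennreal D * emeasure \<nu> (ball x r)"
proof -
  have pos: "emeasure \<nu> (ball x r) > 0"
    using assms(3,4) by (auto simp: msupp_def)
  have le: "emeasure \<nu> (ball x (3 * r)) / emeasure \<nu> (ball x r) \<le> ennreal D"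
    using assms by (auto simp: Federer_on_def)
  show ?thesis
  proof (cases "emeasure \<nu> (ball x r) = \<infinity>")
    case True
    then show ?thesis using assms(2) by (simp add: ennreal_mult_top)
  next
    case False
    have "emeasure \<nu> (ball x (3 * r))
        = emeasure \<nu> (ball x (3 * r)) / emeasure \<nu> (ball x r) * emeasure \<nu> (ball x r)"
      using pos False by (simp add: ennreal_divide_times less_top)
    also have "\<dots> \<le> ennreal D * emeasure \<nu> (ball x r)"
      by (intro mult_right_mono le) simp
    finally show ?thesis .
  qed
qed

lemma Federer_on_ball_power:
  assumes "Federer_on D \<nu> V" "D > 0" "x \<in> msupp \<nu>" "r > 0" "ball x (3 ^ j * r) \<subseteq> V"
  shows "emeasure \<nu> (ball x (3 ^ j * r)) \<le> ennreal (D ^ j) * emeasure \<nu> (ball x r)"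
  using assms(5)
proof (induction j)
  case (Suc j)
  have "3 ^ j * r \<le> 3 ^ Suc j * r" using assms(4) by simp
  then have sub: "ball x (3 ^ j * r) \<subseteq> V" using Suc.prems subset_ball by blast
  have "emeasure \<nu> (ball x (3 * (3 ^ j * r))) \<le> ennreal D * emeasure \<nu> (ball x (3 ^ j * r))"
    using Suc.prems assms by (intro Federer_onD[OF assms(1-3)]) (auto simp: mult.assoc)
  also have "\<dots> \<le> ennreal D * (ennreal (D ^ j) * emeasure \<nu> (ball x r))"
    by (intro mult_left_mono Suc.IH sub) simp
  also have "\<dots> = ennreal (D ^ Suc j) * emeasure \<nu> (ball x r)"
    using assms(2) by (simp add: ennreal_mult mult.assoc)
  finally show ?case by (simp add: mult.assoc)
qed simp

lemma good_fun_on_sublevel: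
  assumes "good_fun_on C \<alpha> \<nu> V g" "C > 0" "\<alpha> > 0" "\<epsilon> > 0"
    and "x \<in> msupp \<nu>" "r > 0" "ball x r \<subseteq> V" "1 \<le> supnorm \<nu> (ball x r) g"
  shows "emeasure \<nu> {y \<in> ball x r. \<bar>g y\<bar> < \<epsilon>} \<le> ennreal (C * \<epsilon> powr \<alpha>) * emeasure \<nu> (ball x r)"
proof -
  let ?N = "supnorm \<nu> (ball x r) g"
  have N0: "?N \<noteq> 0" using assms(8) by auto
  have "ennreal \<epsilon> * 1 \<le> ennreal \<epsilon> * ?N"
    by (rule mult_left_mono[OF assms(8)]) simp
  then have "ennreal \<epsilon> / ?N \<le> ennreal \<epsilon>"
    using N0 by (intro divide_le_posI_ennreal) (auto simp: mult.commute zero_less_iff_neq_zero)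
  then have "enn2real (ennreal \<epsilon> / ?N) \<le> \<epsilon>"
    using assms(4) by (intro enn2real_leI) auto
  then have "enn2real (ennreal \<epsilon> / ?N) powr \<alpha> \<le> \<epsilon> powr \<alpha>"
    using assms by (intro powr_mono2) auto
  then have "good_factor C \<alpha> \<epsilon> ?N \<le> ennreal (C * \<epsilon> powr \<alpha>)"
    using N0 assms by (auto simp: good_factor_def intro!: ennreal_leI mult_left_mono)
  moreover have "emeasure \<nu> {y \<in> ball x r. \<bar>g y\<bar> < \<epsilon>} \<le> good_factor C \<alpha> \<epsilon> ?N * emeasure \<nu> (ball x r)"
    using assms by (auto simp: good_fun_on_def)
  ultimately show ?thesis
    by (meson mult_right_mono order_trans zero_le)
qed

text \<open>
  One step of the induction adds the cost \<open>C\<close> of a single good function and loses a factor \<open>D ^ 4\<close>: three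
  triplings of the radius lead from disjoint balls to the balls on which the induction hypothesis is used,
  and one leads from the original ball to a ball that contains the disjoint ones.
\<close>

primrec nondiv_const :: "real \<Rightarrow> real \<Rightarrow> nat \<Rightarrow> real" where
  "nondiv_const C D 0 = 0"
| "nondiv_const C D (Suc m) = (nondiv_const C D m + C) * D ^ 4"

lemma nondiv_const_nonneg: "C > 0 \<Longrightarrow> D > 0 \<Longrightarrow> 0 \<le> nondiv_const C D m"
  by (induction m) auto

lemma supnorm_mono: "A \<subseteq> B \<Longrightarrow> supnorm \<nu> A g \<le> supnorm \<nu> B g"
  unfolding supnorm_def by (intro SUP_subset_mono) auto

lemma supnorm_ge: "z \<in> B \<Longrightarrow> z \<in> msupp \<nu> \<Longrightarrow> ennreal \<bar>g z\<bar> \<le> supnorm \<nu> B g"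
  unfolding supnorm_def by (intro SUP_upper) auto

lemma open_sublevel_within:
  fixes h :: "'a::topological_space \<Rightarrow> real"
  assumes "open S" "continuous_on S h"
  shows "open {z \<in> S. h z < c}"
proof -
  have "open (h -` {..<c} \<inter> S)"
    using continuous_on_open_vimage[OF assms(1), of h] assms(2) open_lessThan by metis
  moreover have "h -` {..<c} \<inter> S = {z \<in> S. h z < c}" by auto
  ultimately show ?thesis by simp
qed

text \<open>
  The form in which a Vitali covering is exploited: the \<open>A i\<close> may overlap, the \<open>B i\<close> do not.
\<close>

lemma emeasure_UN_le_disjoint_UN:
  assumes "countable I"
    and A: "\<And>i. i \<in> I \<Longrightarrow> A i \<in> sets M" and B: "\<And>i. i \<in> I \<Longrightarrow> B i \<in> sets M"
    and disj: "pairwise (\<lambda>i j. disjnt (B i) (B j)) I"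
    and le: "\<And>i. i \<in> I \<Longrightarrow> emeasure M (A i) \<le> c * emeasure M (B i)"
  shows "emeasure M (\<Union>i\<in>I. A i) \<le> c * emeasure M (\<Union>i\<in>I. B i)"
proof -
  define seq where "seq X n = (if n \<in> to_nat_on I ` I then X (from_nat_into I n) else {})"
    for X :: "_ \<Rightarrow> 'b set" and n
  have ran: "(\<Union>n. seq X n) = (\<Union>i\<in>I. X i)" for X
  proof -
    have "(\<Union>n. seq X n) = (\<Union>n\<in>to_nat_on I ` I. X (from_nat_into I n))"
      by (auto simp: seq_def split: if_splits)
    then show ?thesis using assms(1) by simp
  qed
  have meas: "range (seq X) \<subseteq> sets M" if "\<And>i. i \<in> I \<Longrightarrow> X i \<in> sets M" for X
    using assms(1) that by (auto simp: seq_def)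
  have "emeasure M (\<Union>n. seq A n) \<le> (\<Sum>n. emeasure M (seq A n))"
    by (intro emeasure_subadditive_countably meas A)
  also have "\<dots> \<le> (\<Sum>n. c * emeasure M (seq B n))"
    using assms(1) le by (intro suminf_le) (auto simp: seq_def)
  also have "\<dots> = c * (\<Sum>n. emeasure M (seq B n))"
    by simp
  also have "(\<Sum>n. emeasure M (seq B n)) = emeasure M (\<Union>n. seq B n)"
  proof (intro suminf_emeasure meas B)
    show "disjoint_family (seq B)"
      using disj assms(1) unfolding disjoint_family_on_def seq_def pairwise_def disjnt_def
      by (auto simp: disjoint_iff)
  qed
  finally show ?thesis by (simp add: ran)
qed

lemma supnorm_less_one_nhd:
  fixes g :: "'a::euclidean_space \<Rightarrow> real"
  assumes "continuous_on V g" "ball y s \<subseteq> V" "s > 0" "\<bar>g y\<bar> < 1"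
  obtains r where "r > 0" "supnorm \<nu> (ball y r) g < 1"
proof -
  obtain c where c: "\<bar>g y\<bar> < c" "c < 1" using assms(4) dense by blast
  have "open {z \<in> ball y s. \<bar>g z\<bar> < c}"
    using assms(1,2) continuous_on_subset by (intro open_sublevel_within continuous_intros) auto
  moreover have "y \<in> {z \<in> ball y s. \<bar>g z\<bar> < c}" using c assms(3) by simp
  ultimately obtain r where r: "r > 0" "ball y r \<subseteq> {z \<in> ball y s. \<bar>g z\<bar> < c}"
    using openE by blast
  have "supnorm \<nu> (ball y r) g \<le> ennreal c"
    unfolding supnorm_def using r(2) by (intro SUP_least ennreal_leI) force
  also have "\<dots> < 1" using c by (simp add: ennreal_less_one_iff)
  finally show thesis using that r by blast
qed

lemma ball_subset_ball_of_dist_le: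
  fixes x :: "'a::metric_space"
  shows "dist x y + r \<le> s \<Longrightarrow> ball y r \<subseteq> ball x s"
proof
  fix z assume "dist x y + r \<le> s" "z \<in> ball y r"
  then show "z \<in> ball x s" using dist_triangle[of x z y] by auto
qed

text \<open>
  Let \<open>y\<close> be a point where some function of the family is below \<open>1\<close>. Among the radii \<open>r\<close> for which some
  function of the family has supremum below \<open>1\<close> on \<open>ball y r\<close>, choose one that is larger than a third of
  their least upper bound; by the hypothesis on \<open>ball x r0\<close> all these radii are below \<open>2 * r0\<close>. The
  corresponding function \<open>s\<close> is small on \<open>ball y r\<close>, yet every function of the family has supremum at
  least \<open>1\<close> on \<open>ball y (3 * r)\<close>. So the induction hypothesis applies there to the neighbours of \<open>s\<close>, and a
  point of \<open>ball y r\<close> that is marked for the neighbours is marked for the family as soon as the value of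
  \<open>s\<close> is at least \<open>\<epsilon>\<close>; the exceptions are few because \<open>s\<close> is good. Vitali's covering lemma selects disjoint
  balls of radius \<open>r / 5\<close>, and the Federer property adds up the estimates.

  The radius is chosen only up to the factor \<open>3\<close> because the least upper bound need not be attained when
  infinitely many functions are small at \<open>y\<close>. The Borel set \<open>N\<close> appears because the set of unmarked points
  of an uncountable family need not be measurable. The factor \<open>7 ^ m\<close> accounts for the region that the balls
  reach: in each step their centres lie in \<open>ball x r0\<close> and their radii \<open>3 * r\<close> are below \<open>6 * r0\<close>.
\<close>

proposition quantitative_nondivergence:
  fixes \<nu> :: "'a::euclidean_space measure" and \<psi> :: "'s \<Rightarrow> 'a \<Rightarrow> real"
  assumes borel: "sets \<nu> = sets borel"
    and Fed: "Federer_on D \<nu> V" and pos: "C > 0" "\<alpha> > 0" "D > 0" "\<epsilon> > 0"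
    and R: "symp R" "irreflp R"
    and cont: "\<And>s. s \<in> P \<Longrightarrow> continuous_on V (\<psi> s)"
    and nonneg: "\<And>s z. 0 \<le> \<psi> s z"
    and good: "\<And>s. s \<in> P \<Longrightarrow> good_fun_on C \<alpha> \<nu> V (\<psi> s)"
    and cl: "cliques_le R m P"
    and x: "x \<in> msupp \<nu>" "0 < r0" "ball x (7 ^ m * r0) \<subseteq> V"
    and sup: "\<And>s. s \<in> P \<Longrightarrow> 1 \<le> supnorm \<nu> (ball x r0) (\<psi> s)"
  shows "\<exists>N\<in>sets borel. {z \<in> ball x r0 \<inter> msupp \<nu>. \<not> marked R \<epsilon> (\<lambda>s. \<psi> s z) P} \<subseteq> N
      \<and> emeasure \<nu> N \<le> ennreal (nondiv_const C D m * \<epsilon> powr \<alpha>) * emeasure \<nu> (ball x r0)"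
  using cl cont good x sup
proof (induction m arbitrary: P x r0)
  case 0
  then have "P = {}" using cliques_le_0 by blast
  then have "marked R \<epsilon> (\<lambda>s. \<psi> s z) P" for z by (auto intro: marked.large)
  then show ?case by (intro bexI[of _ "{}"]) auto
next
  case (Suc m)
  note cl = Suc.prems(1) and cont = Suc.prems(2) and good = Suc.prems(3)
    and x = Suc.prems(4-6) and sup = Suc.prems(7)
  let ?K = "nondiv_const C D m"
  define E where "E = {y \<in> ball x r0 \<inter> msupp \<nu>. \<exists>s\<in>P. \<psi> s y < 1}"
  have K0: "0 \<le> ?K" using nondiv_const_nonneg pos by blast
  have pow7: "(1::real) \<le> 7 ^ m" by simp
  have "7 * r0 \<le> 7 ^ Suc m * r0" using pow7 x(2) by simp
  then have V7: "ball x (7 * r0) \<subseteq> V" using x(3) subset_ball by blast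
  have near: "\<exists>r s. 0 < r \<and> r < 2 * r0 \<and> s \<in> P \<and> supnorm \<nu> (ball y r) (\<psi> s) < 1 \<and>
      (\<forall>t\<in>P. 1 \<le> supnorm \<nu> (ball y (3 * r)) (\<psi> t))" if y: "y \<in> E" for y
  proof -
    define T where "T = {r. 0 < r \<and> (\<exists>s\<in>P. supnorm \<nu> (ball y r) (\<psi> s) < 1)}"
    have yx: "dist x y < r0" using y by (auto simp: E_def)
    have T2: "r < 2 * r0" if "r \<in> T" for r
    proof (rule ccontr)
      assume "\<not> r < 2 * r0"
      then have "ball x r0 \<subseteq> ball y r"
        using yx by (intro ball_subset_ball_of_dist_le) (auto simp: dist_commute)
      then have "supnorm \<nu> (ball x r0) (\<psi> s) \<le> supnorm \<nu> (ball y r) (\<psi> s)" for s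
        by (rule supnorm_mono)
      then show False using that sup by (auto simp: T_def) (meson leD order_trans)
    qed
    obtain s where s: "s \<in> P" "\<psi> s y < 1" using y by (auto simp: E_def)
    have "ball y r0 \<subseteq> ball x (7 * r0)"
      using yx x(2) by (intro ball_subset_ball_of_dist_le) auto
    obtain r1 where r1: "r1 > 0" "supnorm \<nu> (ball y r1) (\<psi> s) < 1"
      using supnorm_less_one_nhd[OF cont[OF s(1)], of y r0 \<nu>] s nonneg[of s y] V7 x(2)
        \<open>ball y r0 \<subseteq> ball x (7 * r0)\<close> by (metis abs_of_nonneg subset_trans)
    then have r1T: "r1 \<in> T" using s by (auto simp: T_def)
    have bdd: "bdd_above T" using T2 by (intro bdd_aboveI[of _ "2 * r0"]) (auto simp: less_imp_le)
    have Spos: "0 < Sup T" using cSup_upper[OF r1T bdd] r1 by linarith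
    then obtain r where r: "r \<in> T" "Sup T / 3 < r"
      using less_cSup_iff[OF _ bdd, of "Sup T / 3"] r1T by auto
    \<comment> \<open>Since \<open>3 * r\<close> exceeds the least upper bound, no function stays below \<open>1\<close> on the larger ball.\<close>
    have "3 * r \<notin> T" using cSup_upper[OF _ bdd, of "3 * r"] r(2) by auto
    then have "\<forall>t\<in>P. 1 \<le> supnorm \<nu> (ball y (3 * r)) (\<psi> t)"
      using r by (auto simp: T_def not_less)
    then show ?thesis using r(1) T2 by (auto simp: T_def)
  qed
  then obtain rad sel where rs: "\<And>y. y \<in> E \<Longrightarrow> 0 < rad y \<and> rad y < 2 * r0 \<and> sel y \<in> P \<and>
      supnorm \<nu> (ball y (rad y)) (\<psi> (sel y)) < 1 \<and>
      (\<forall>t\<in>P. 1 \<le> supnorm \<nu> (ball y (3 * rad y)) (\<psi> t))"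
    by metis
  obtain Y where Y: "countable Y" "Y \<subseteq> E"
    and disj: "pairwise (\<lambda>y z. disjnt (ball y (rad y / 5)) (ball z (rad z / 5))) Y"
    and cover: "E \<subseteq> (\<Union>y\<in>Y. ball y (5 * (rad y / 5)))"
  proof (rule Vitali_covering_lemma_balls[where S = E and K = E and a = "\<lambda>y. y" and r = "\<lambda>y. rad y / 5" and B = "2 * r0"])
    show "E \<subseteq> (\<Union>y\<in>E. ball y (rad y / 5))" using rs by force
    show "0 < rad y / 5 \<and> rad y / 5 \<le> 2 * r0" if "y \<in> E" for y using rs[OF that] by auto
  qed (auto intro: that)
  have inV: "ball y (7 ^ m * (3 * rad y)) \<subseteq> V" if "y \<in> Y" for y
  proof -
    have "dist x y < r0" "0 < rad y" "rad y < 2 * r0" using rs[of y] Y that by (auto simp: E_def)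
    moreover have "r0 \<le> 7 ^ m * r0" using x(2) by simp
    moreover have "7 ^ m * (3 * rad y) \<le> 7 ^ m * (6 * r0)"
      using \<open>rad y < 2 * r0\<close> by simp
    ultimately have "dist x y + 7 ^ m * (3 * rad y) \<le> 7 ^ m * r0 + 7 ^ m * (6 * r0)"
      by linarith
    also have "\<dots> = 7 ^ Suc m * r0" by simp
    finally have "ball y (7 ^ m * (3 * rad y)) \<subseteq> ball x (7 ^ Suc m * r0)"
      by (rule ball_subset_ball_of_dist_le)
    then show ?thesis using x(3) by blast
  qed
  have step: "\<exists>A\<in>sets borel. {z \<in> ball y (rad y) \<inter> msupp \<nu>. \<not> marked R \<epsilon> (\<lambda>s. \<psi> s z) P} \<subseteq> A
      \<and> emeasure \<nu> A \<le> ennreal ((?K + C) * D ^ 3 * \<epsilon> powr \<alpha>) * emeasure \<nu> (ball y (rad y / 5))"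
    if "y \<in> Y" for y
  proof -
    let ?s = "sel y" and ?B = "ball y (3 * rad y)"
    have y: "y \<in> msupp \<nu>" "0 < rad y" "rad y < 2 * r0" "?s \<in> P" "supnorm \<nu> (ball y (rad y)) (\<psi> ?s) < 1"
      "\<And>t. t \<in> P \<Longrightarrow> 1 \<le> supnorm \<nu> ?B (\<psi> t)"
      using rs[of y] Y that by (auto simp: E_def)
    have "3 * rad y \<le> 7 ^ m * (3 * rad y)" using y(2) by simp
    then have BV: "?B \<subseteq> V" using inV[OF that] subset_ball by blast
    have "\<exists>N\<in>sets borel. {z \<in> ?B \<inter> msupp \<nu>. \<not> marked R \<epsilon> (\<lambda>s. \<psi> s z) {t \<in> P. R ?s t}} \<subseteq> N
        \<and> emeasure \<nu> N \<le> ennreal (?K * \<epsilon> powr \<alpha>) * emeasure \<nu> ?B"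
      using cont good y inV[OF that]
      by (intro Suc.IH cliques_le_neighbours[OF R cl y(4)]) auto
    then obtain N where N: "N \<in> sets borel"
      "{z \<in> ?B \<inter> msupp \<nu>. \<not> marked R \<epsilon> (\<lambda>s. \<psi> s z) {t \<in> P. R ?s t}} \<subseteq> N"
      "emeasure \<nu> N \<le> ennreal (?K * \<epsilon> powr \<alpha>) * emeasure \<nu> ?B" by blast
    define L where "L = {z \<in> ?B. \<bar>\<psi> ?s z\<bar> < \<epsilon>}"
    have "open L"
      unfolding L_def using continuous_on_subset[OF cont[OF y(4)] BV]
      by (intro open_sublevel_within continuous_intros) auto
    then have Lm: "L \<in> sets \<nu>" using borel by auto
    have Le: "emeasure \<nu> L \<le> ennreal (C * \<epsilon> powr \<alpha>) * emeasure \<nu> ?B"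
      unfolding L_def using pos y BV by (intro good_fun_on_sublevel[OF good]) auto
    have "{z \<in> ball y (rad y) \<inter> msupp \<nu>. \<not> marked R \<epsilon> (\<lambda>s. \<psi> s z) P} \<subseteq> N \<union> L"
    proof
      fix z assume z: "z \<in> {z \<in> ball y (rad y) \<inter> msupp \<nu>. \<not> marked R \<epsilon> (\<lambda>s. \<psi> s z) P}"
      have "ennreal \<bar>\<psi> ?s z\<bar> \<le> supnorm \<nu> (ball y (rad y)) (\<psi> ?s)"
        using z by (intro supnorm_ge) auto
      also have "\<dots> < 1" by (rule y(5))
      finally have "ennreal \<bar>\<psi> ?s z\<bar> < 1" .
      then have le1: "\<psi> ?s z \<le> 1" by (simp add: ennreal_less_one_iff)
      have zB: "z \<in> ?B" using z y(2) by auto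
      show "z \<in> N \<union> L"
      proof (rule ccontr)
        assume "z \<notin> N \<union> L"
        then have "\<epsilon> \<le> \<psi> ?s z" "marked R \<epsilon> (\<lambda>s. \<psi> s z) {t \<in> P. R ?s t}"
          using N(2) z zB nonneg[of ?s z] by (auto simp: L_def)
        then have "marked R \<epsilon> (\<lambda>s. \<psi> s z) P" 
          using le1 marked.small[where \<phi> = "\<lambda>s. \<psi> s z", OF y(4)] by blast
        then show False using z by simp
      qed
    qed
    moreover have "emeasure \<nu> (N \<union> L) \<le> ennreal ((?K + C) * D ^ 3 * \<epsilon> powr \<alpha>) * emeasure \<nu> (ball y (rad y / 5))"
    proof -
      \<comment> \<open>Two triplings of \<open>rad y / 5\<close> would not reach \<open>3 * rad y\<close>.\<close>
      have "emeasure \<nu> ?B = emeasure \<nu> (ball y (3 ^ 3 * (rad y / 9)))" by simp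
      also have "\<dots> \<le> ennreal (D ^ 3) * emeasure \<nu> (ball y (rad y / 9))"
        using y BV by (intro Federer_on_ball_power[OF Fed pos(3)]) auto
      also have "\<dots> \<le> ennreal (D ^ 3) * emeasure \<nu> (ball y (rad y / 5))"
        using y borel by (intro mult_left_mono emeasure_mono subset_ball) auto
      finally have B3: "emeasure \<nu> ?B \<le> ennreal (D ^ 3) * emeasure \<nu> (ball y (rad y / 5))" .
      have "emeasure \<nu> (N \<union> L) \<le> emeasure \<nu> N + emeasure \<nu> L"
        using N Lm borel by (intro emeasure_subadditive) auto
      also have "\<dots> \<le> ennreal (?K * \<epsilon> powr \<alpha>) * emeasure \<nu> ?B + ennreal (C * \<epsilon> powr \<alpha>) * emeasure \<nu> ?B"
        by (intro add_mono N Le)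
      also have "\<dots> = ennreal ((?K + C) * \<epsilon> powr \<alpha>) * emeasure \<nu> ?B"
        using pos K0 by (simp add: distrib_right ennreal_plus)
      also have "\<dots> \<le> ennreal ((?K + C) * \<epsilon> powr \<alpha>) * (ennreal (D ^ 3) * emeasure \<nu> (ball y (rad y / 5)))"
        by (intro mult_left_mono B3) simp
      also have "\<dots> = ennreal ((?K + C) * D ^ 3 * \<epsilon> powr \<alpha>) * emeasure \<nu> (ball y (rad y / 5))"
        using pos K0
        by (subst mult.assoc[symmetric], subst ennreal_mult[symmetric]) (auto simp: mult_ac)
      finally show ?thesis .
    qed
    ultimately show ?thesis using N(1) Lm borel by (intro bexI[of _ "N \<union> L"]) auto
  qed
  then have "\<forall>y\<in>Y. \<exists>A. A \<in> sets borel
      \<and> {z \<in> ball y (rad y) \<inter> msupp \<nu>. \<not> marked R \<epsilon> (\<lambda>s. \<psi> s z) P} \<subseteq> A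
      \<and> emeasure \<nu> A \<le> ennreal ((?K + C) * D ^ 3 * \<epsilon> powr \<alpha>) * emeasure \<nu> (ball y (rad y / 5))"
    by blast
  from bchoice[OF this] obtain A where A: "\<forall>y\<in>Y. A y \<in> sets borel
      \<and> {z \<in> ball y (rad y) \<inter> msupp \<nu>. \<not> marked R \<epsilon> (\<lambda>s. \<psi> s z) P} \<subseteq> A y
      \<and> emeasure \<nu> (A y) \<le> ennreal ((?K + C) * D ^ 3 * \<epsilon> powr \<alpha>) * emeasure \<nu> (ball y (rad y / 5))"
    by blast
  show ?case
  proof (intro bexI conjI)
    show "(\<Union>y\<in>Y. A y) \<in> sets borel" using A Y(1) by auto
    show "{z \<in> ball x r0 \<inter> msupp \<nu>. \<not> marked R \<epsilon> (\<lambda>s. \<psi> s z) P} \<subseteq> (\<Union>y\<in>Y. A y)"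
    proof
      fix z assume z: "z \<in> {z \<in> ball x r0 \<inter> msupp \<nu>. \<not> marked R \<epsilon> (\<lambda>s. \<psi> s z) P}"
      then have "z \<in> E" using marked.large[of P "\<lambda>s. \<psi> s z" R \<epsilon>] by (force simp: E_def not_less)
      then obtain y where "y \<in> Y" "z \<in> ball y (rad y)" using cover by auto
      then show "z \<in> (\<Union>y\<in>Y. A y)" using A z by blast
    qed
    have "(\<Union>y\<in>Y. ball y (rad y / 5)) \<subseteq> ball x (3 * r0)"
    proof (intro UN_least ball_subset_ball_of_dist_le)
      fix y assume "y \<in> Y"
      then have "y \<in> E" using Y by blast
      then have "dist x y < r0" "rad y < 2 * r0" using rs[of y] by (auto simp: E_def)
      then show "dist x y + rad y / 5 \<le> 3 * r0" using x(2) by linarith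
    qed
    then have "emeasure \<nu> (\<Union>y\<in>Y. ball y (rad y / 5)) \<le> emeasure \<nu> (ball x (3 * r0))"
      using borel by (intro emeasure_mono) auto
    also have "\<dots> \<le> ennreal D * emeasure \<nu> (ball x r0)"
    proof (rule Federer_onD[OF Fed pos(3) x(1,2)])
      show "ball x (3 * r0) \<subseteq> V" using V7 x(2) subset_ball[of "3 * r0" "7 * r0" x] by auto
    qed
    finally have U: "emeasure \<nu> (\<Union>y\<in>Y. ball y (rad y / 5)) \<le> ennreal D * emeasure \<nu> (ball x r0)" .
    have "emeasure \<nu> (\<Union>y\<in>Y. A y)
        \<le> ennreal ((?K + C) * D ^ 3 * \<epsilon> powr \<alpha>) * emeasure \<nu> (\<Union>y\<in>Y. ball y (rad y / 5))"
      using A Y disj borel by (intro emeasure_UN_le_disjoint_UN) auto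
    also have "\<dots> \<le> ennreal ((?K + C) * D ^ 3 * \<epsilon> powr \<alpha>) * (ennreal D * emeasure \<nu> (ball x r0))"
      by (intro mult_left_mono U) simp
    also have "\<dots> = ennreal ((?K + C) * D ^ 3 * \<epsilon> powr \<alpha> * D) * emeasure \<nu> (ball x r0)"
      using pos K0
      by (subst mult.assoc[symmetric], subst ennreal_mult[symmetric]) auto
    also have "(?K + C) * D ^ 3 * \<epsilon> powr \<alpha> * D = nondiv_const C D (Suc m) * \<epsilon> powr \<alpha>"
      by (simp add: power_numeral_reduce)
    finally show "emeasure \<nu> (\<Union>y\<in>Y. A y)
        \<le> ennreal (nondiv_const C D (Suc m) * \<epsilon> powr \<alpha>) * emeasure \<nu> (ball x r0)" .
  qed
qed

section \<open>Determinants of partially prescribed rows\<close>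

text \<open>
  These are row operations with the pivot row \<open>w\<close>.
\<close>

lemma det_replaced_row_shift:
  fixes r :: "'k::finite \<Rightarrow> real^'k"
  assumes "finite S" "k \<notin> S"
  shows "det (\<chi> i. if i = k then w else if i \<in> S then r i + a i *s w else r i)
       = det (\<chi> i. if i = k then w else r i)"
  using assms
proof (induction S)
  case (insert l S)
  let ?A = "(\<chi> i. if i = k then w else if i \<in> S then r i + a i *s w else r i) :: real^'k^'k"
  have "(\<chi> i. if i = k then w else if i \<in> insert l S then r i + a i *s w else r i)
      = (\<chi> i. if i = l then row l ?A + a l *s row k ?A else row i ?A)"
    using insert by (auto simp: vec_eq_iff row_def)
  then show ?case
    using insert det_row_operation[where i = l and j = k and c = "a l" and A = ?A] by auto
qed (simp cong: if_cong)

text \<open>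
  Multilinear expansion would give all products of the \<open>a k\<close>, but a term of degree two or more contains the
  row \<open>w\<close> twice and vanishes. This is why the covolumes below are affine in \<open>y\<close>, so that linear combinations
  of \<open>1, f\<^sub>1, \<dots>, f\<^sub>n\<close> are the only functions that occur.
\<close>

lemma det_rank_one_update:
  fixes r :: "'k::finite \<Rightarrow> real^'k"
  shows "det (\<chi> i. r i + a i *s w)
       = det (\<chi> i. r i) + (\<Sum>k\<in>UNIV. a k * det (\<chi> i. if i = k then w else r i))"
proof -
  have "det (\<chi> i. if i \<in> S then r i + a i *s w else r i)
      = det (\<chi> i. r i) + (\<Sum>k\<in>S. a k * det (\<chi> i. if i = k then w else r i))"
    if "finite S" for S
    using that
  proof (induction S)
    case (insert k S)
    let ?rest = "\<lambda>i. if i \<in> S then r i + a i *s w else r i"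
    have "(\<chi> i. if i \<in> insert k S then r i + a i *s w else r i)
        = (\<chi> i. if i = k then r k + a k *s w else ?rest i)"
      by (auto simp: vec_eq_iff)
    then have "det (\<chi> i. if i \<in> insert k S then r i + a i *s w else r i)
        = det (\<chi> i. if i = k then r k else ?rest i) + a k * det (\<chi> i. if i = k then w else ?rest i)"
      by (simp add: det_row_add det_row_mul)
    also have "(\<chi> i. if i = k then r k else ?rest i) = (\<chi> i. ?rest i)"
      using insert.hyps by (auto simp: vec_eq_iff)
    also have "det (\<chi> i. if i = k then w else ?rest i) = det (\<chi> i. if i = k then w else r i)"
      using det_replaced_row_shift[OF insert.hyps, of w r a] by simp
    finally show ?case using insert by simp
  qed simp
  from this[of UNIV] show ?thesis by simp
qed

lemma det_row_combination:
  fixes c :: "'k::finite \<Rightarrow> real^'k"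
  assumes "finite S"
  shows "det (\<chi> i. if i = l then (\<Sum>s\<in>S. x s *s v s) else c i)
       = (\<Sum>s\<in>S. x s * det (\<chi> i. if i = l then v s else c i))"
  by (simp add: det_linear_row_sum[OF assms] det_row_mul)

abbreviation partial_rows ::
  "'k set \<Rightarrow> ('k \<Rightarrow> real^'k) \<Rightarrow> ('k \<Rightarrow> real^'k) \<Rightarrow> real^'k^'k::finite" where
  "partial_rows J b W \<equiv> (\<chi> i. if i \<in> J then b i else W i)"

definition indep_on :: "'k set \<Rightarrow> ('k \<Rightarrow> real^'k::finite) \<Rightarrow> bool" where
  "indep_on J b \<longleftrightarrow> inj_on b J \<and> independent (b ` J)"

lemma indep_on_insert:
  assumes "indep_on J b" "v \<notin> span (b ` J)" "i \<notin> J"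
  shows "indep_on (insert i J) (b(i := v))"
proof -
  have eq: "b(i := v) ` J = b ` J" using assms(3) by auto
  have "v \<notin> b ` J" using assms(2) span_base[of v "b ` J"] by auto
  moreover have "inj_on (b(i := v)) J" using assms by (auto simp: indep_on_def inj_on_def)
  moreover have "independent (insert v (b ` J))"
    using assms by (simp add: indep_on_def independent_insertI)
  ultimately show ?thesis using assms(3) eq by (auto simp: indep_on_def)
qed

lemma span_axes: "span (range (\<lambda>s. axis s (1::real))) = (UNIV :: (real^'k::finite) set)"
proof -
  have "(Basis :: (real^'k) set) = range (\<lambda>s. axis s 1)"
    unfolding Basis_vec_def by (simp add: UNION_singleton_eq_range)
  then have "span (range (\<lambda>s. axis s 1)) = (span Basis :: (real^'k) set)" by simp
  then show ?thesis unfolding span_Basis .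
qed

text \<open>
  Steinitz exchange: as long as rows are missing, some coordinate axis lies outside the span of those present.
  In terms of multivectors: an independent family has a nonzero Pluecker coordinate.
\<close>

lemma indep_on_completion:
  fixes b :: "'k::finite \<Rightarrow> real^'k"
  assumes "indep_on J b"
  obtains \<sigma> :: "'k \<Rightarrow> 'k" where "det (partial_rows J b (\<lambda>i. axis (\<sigma> i) 1)) \<noteq> 0"
proof -
  have "\<exists>\<sigma> :: 'k \<Rightarrow> 'k. det (partial_rows J b (\<lambda>i. axis (\<sigma> i) 1)) \<noteq> 0"
    using assms
  proof (induction "card (- J)" arbitrary: J b)
    case 0
    then have J: "J = UNIV" by auto
    let ?A = "(\<chi> i. b i) :: real^'k^'k"
    have rows: "rows ?A = range b" by (auto simp: rows_def row_def vec_eq_iff image_def)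
    have "rank ?A = CARD('k)"
      using 0 J by (simp add: row_rank_def rows indep_on_def dim_eq_card_independent card_image)
    then show ?case using J by (simp add: det_eq_0_rank)
  next
    case (Suc m)
    then have "- J \<noteq> {}" by auto
    then obtain i where i: "i \<notin> J" by auto
    have "dim (span (b ` J)) \<le> card (b ` J)" by (simp add: dim_le_card')
    also have "\<dots> \<le> card J" by (rule card_image_le) simp
    also have "\<dots> < CARD('k)" using i by (intro psubset_card_mono) auto
    finally have "dim (span (b ` J)) < CARD('k)" .
    then have "span (b ` J) \<noteq> UNIV"
    proof (rule contrapos_pn)
      assume "span (b ` J) = UNIV"
      then show "\<not> dim (span (b ` J)) < CARD('k)" by (simp only:) simp
    qed
    then obtain s where s: "axis s 1 \<notin> span (b ` J)"
      using span_axes span_minimal[of "range (\<lambda>s. axis s (1::real))" "span (b ` J)"] by auto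
    have "m = card (- insert i J)"
      using Suc.hyps(2) i by (metis Compl_insert ComplI card_Diff_singleton diff_Suc_1)
    from Suc.hyps(1)[OF this indep_on_insert[OF Suc.prems s i]] obtain \<sigma> :: "'k \<Rightarrow> 'k" where
      "det (partial_rows (insert i J) (b(i := axis s 1)) (\<lambda>i. axis (\<sigma> i) 1)) \<noteq> 0" by blast
    moreover have "partial_rows (insert i J) (b(i := axis s 1)) (\<lambda>i. axis (\<sigma> i) 1)
        = partial_rows J b (\<lambda>l. axis ((\<sigma>(i := s)) l) 1)"
      using i by (auto simp: vec_eq_iff)
    ultimately show ?case by metis
  qed
  then show thesis using that by blast
qed

text \<open>
  The two matrices differ by a left factor that acts on the rows in \<open>J\<close> alone and does not depend on the other
  rows. In terms of multivectors: the top exterior power of a subspace is a line.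
\<close>

lemma partial_rows_change_of_basis:
  fixes b b' :: "'k::finite \<Rightarrow> real^'k"
  assumes "inj_on b J" "\<And>i. i \<in> J \<Longrightarrow> b' i \<in> span (b ` J)"
  obtains c where "\<And>W. det (partial_rows J b' W) = c * det (partial_rows J b W)"
proof -
  have "\<exists>u. b' i = (\<Sum>l\<in>J. u l *\<^sub>R b l)" if "i \<in> J" for i
  proof -
    have "b' i \<in> range (\<lambda>u. \<Sum>v\<in>b ` J. u v *\<^sub>R v)"
      using assms(2)[OF that] span_finite[of "b ` J"] by simp
    then obtain u where "b' i = (\<Sum>v\<in>b ` J. u v *\<^sub>R v)" by blast
    then have "b' i = (\<Sum>l\<in>J. u (b l) *\<^sub>R b l)" using assms(1) by (simp add: sum.reindex)
    then show ?thesis by (intro exI[of _ "\<lambda>l. u (b l)"])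
  qed
  then obtain u where u: "\<And>i. i \<in> J \<Longrightarrow> b' i = (\<Sum>l\<in>J. u i l *\<^sub>R b l)" by metis
  define A where "A = ((\<chi> i l. if i \<in> J then (if l \<in> J then u i l else 0) else if i = l then 1 else 0) :: real^'k^'k)"
  have "partial_rows J b' W = A ** partial_rows J b W" for W
  proof -
    have "(A ** partial_rows J b W) $ i $ j = partial_rows J b' W $ i $ j" for i j
    proof -
      have "(A ** partial_rows J b W) $ i $ j = (\<Sum>l\<in>UNIV. A $ i $ l * partial_rows J b W $ l $ j)"
        by (simp add: matrix_matrix_mult_def)
      also have "\<dots> = partial_rows J b' W $ i $ j"
      proof (cases "i \<in> J")
        case True
        have "(\<Sum>l\<in>UNIV. A $ i $ l * partial_rows J b W $ l $ j)
            = (\<Sum>l\<in>UNIV. if l \<in> J then u i l * b l $ j else 0)"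
          by (rule sum.cong) (use True in \<open>auto simp: A_def\<close>)
        then show ?thesis using True u[OF True] by (simp add: sum.If_cases)
      next
        case False
        have "(\<Sum>l\<in>UNIV. A $ i $ l * partial_rows J b W $ l $ j)
            = (\<Sum>l\<in>UNIV. if l = i then W i $ j else 0)"
          by (rule sum.cong) (use False in \<open>auto simp: A_def\<close>)
        then show ?thesis using False by simp
      qed
      finally show ?thesis .
    qed
    then show ?thesis by (simp add: vec_eq_iff)
  qed
  then show thesis using that[of "det A"] by (simp add: det_mul)
qed

section \<open>Integer frames of rational subspaces\<close>

definition int_vecs :: "(real^'k) set" where
  "int_vecs = {v. \<forall>i. v $ i \<in> \<int>}"

definition rational_subspace :: "(real^'k::finite) set \<Rightarrow> bool" where
  "rational_subspace L \<longleftrightarrow> (\<exists>A\<subseteq>int_vecs. L = span A)"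

lemma subspace_rational: "rational_subspace L \<Longrightarrow> subspace L"
  by (auto simp: rational_subspace_def)

lemma rational_subspace_zero: "rational_subspace {0}"
  by (auto simp: rational_subspace_def intro!: exI[of _ "{}"])

lemma rational_subspace_extend:
  assumes "rational_subspace M" "v \<in> int_vecs"
  shows "rational_subspace (span (insert v M))"
proof -
  obtain A where A: "A \<subseteq> int_vecs" "M = span A" using assms(1) by (auto simp: rational_subspace_def)
  have "span (insert v M) = span (insert v A)"
    unfolding A(2) by (simp add: span_insert span_span)
  then show ?thesis
    using A(1) assms(2) unfolding rational_subspace_def by (intro exI[of _ "insert v A"]) auto
qed

text \<open>
  An increasing chain of index sets, one of each cardinality. Frames of a subspace of dimension \<open>j\<close> are indexed
  by \<open>seg j\<close>; thus two frames of the same subspace are compared without reindexing, and a further vector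
  goes into the next free row.
\<close>

definition seg :: "nat \<Rightarrow> 'k::finite set" where
  "seg j = {i. to_nat_on (UNIV :: 'k set) i < j}"

lemma bij_to_nat_on_UNIV: "bij_betw (to_nat_on (UNIV :: 'k::finite set)) UNIV {..<CARD('k)}"
  by (rule to_nat_on_finite) simp

lemma seg_Suc:
  assumes "j < CARD('k::finite)"
  obtains i :: "'k::finite" where "i \<notin> seg j" "seg (Suc j) = insert i (seg j)"
proof -
  let ?e = "to_nat_on (UNIV :: 'k set)"
  have "j \<in> ?e ` UNIV" using bij_to_nat_on_UNIV[where 'k = 'k] assms by (auto simp: bij_betw_def)
  then obtain i where i: "?e i = j" by auto
  have "inj ?e" using bij_to_nat_on_UNIV[where 'k = 'k] by (simp add: bij_betw_def)
  then have "?e l = j \<longleftrightarrow> l = i" for l using inj_eq[of ?e l i] i by simp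
  then have "seg (Suc j) = insert i (seg j)"
    unfolding seg_def less_Suc_eq by blast
  moreover have "i \<notin> seg j" using i by (simp add: seg_def)
  ultimately show thesis by (intro that)
qed

lemma card_seg: "j \<le> CARD('k) \<Longrightarrow> card (seg j :: 'k::finite set) = j"
proof (induction j)
  case 0
  then show ?case by (simp add: seg_def)
next
  case (Suc j)
  then have "j < CARD('k)" by simp
  from seg_Suc[OF this] obtain i :: 'k where "i \<notin> seg j" "seg (Suc j) = insert i (seg j)" .
  then show ?case using Suc by simp
qed

definition lattice_frame :: "(real^'k::finite) set \<Rightarrow> ('k \<Rightarrow> real^'k) \<Rightarrow> bool" where
  "lattice_frame L b \<longleftrightarrow> b ` seg (dim L) \<subseteq> L \<inter> int_vecs \<and> indep_on (seg (dim L)) b"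

abbreviation frame_det ::
  "(real^'k::finite) set \<Rightarrow> ('k \<Rightarrow> real^'k) \<Rightarrow> ('k \<Rightarrow> real^'k) \<Rightarrow> real" where
  "frame_det L b W \<equiv> det (partial_rows (seg (dim L)) b W)"

lemma dim_le_CARD: "dim (L :: (real^'k::finite) set) \<le> CARD('k)"
  using dim_subset_UNIV[of L] by simp

lemma lattice_frame_exists:
  fixes L :: "(real^'k::finite) set"
  assumes "rational_subspace L"
  shows "\<exists>b. lattice_frame L b"
proof -
  obtain A where A: "A \<subseteq> int_vecs" "L = span A" using assms by (auto simp: rational_subspace_def)
  obtain B where B: "B \<subseteq> A" "independent B" "A \<subseteq> span B" "card B = dim A"
    using basis_exists[of A] by blast
  have fin: "finite B" using B(2) by (rule independent_imp_finite)
  have "card (seg (dim L) :: 'k set) = card B"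
    using card_seg[OF dim_le_CARD[of L]] B(4) A(2) by simp
  then obtain b where b: "bij_betw b (seg (dim L) :: 'k set) B"
    using finite_same_card_bij[OF finite fin] by blast
  have "B \<subseteq> L" using B(1) A(2) span_superset[of A] by blast
  then have "lattice_frame L b"
    using b B A by (auto simp: lattice_frame_def indep_on_def bij_betw_def)
  then show ?thesis by blast
qed

lemma span_lattice_frame:
  fixes L :: "(real^'k::finite) set"
  assumes "rational_subspace L" "lattice_frame L b"
  shows "span (b ` seg (dim L)) = L"
proof
  have b: "b ` seg (dim L) \<subseteq> L" "inj_on b (seg (dim L))" "independent (b ` seg (dim L))"
    using assms(2) by (auto simp: lattice_frame_def indep_on_def)
  show "span (b ` seg (dim L)) \<subseteq> L"
    using b(1) subspace_rational[OF assms(1)] by (rule span_minimal)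
  have "dim L \<le> card (b ` seg (dim L))"
    using b(2) by (simp add: card_image card_seg[OF dim_le_CARD])
  then show "L \<subseteq> span (b ` seg (dim L))"
    by (rule card_ge_dim_independent[OF b(1,3)])
qed

lemma det_in_Ints:
  assumes "\<And>i j. A $ i $ j \<in> \<int>"
  shows "det (A :: real^'k^'k::finite) \<in> \<int>"
  unfolding det_def by (intro Ints_sum Ints_mult Ints_prod assms Ints_of_int)

text \<open>
  A norm of the multivector of the frame. On lattice frames its values are positive integers, so some frame
  attains the least one.
\<close>

definition frame_height :: "(real^'k::finite) set \<Rightarrow> ('k \<Rightarrow> real^'k) \<Rightarrow> real" where
  "frame_height L b = (\<Sum>\<sigma>\<in>UNIV. \<bar>frame_det L b (\<lambda>i. axis (\<sigma> i) 1)\<bar>)"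

lemma frame_minor_in_Ints:
  assumes "lattice_frame L b"
  shows "frame_det L b (\<lambda>i. axis (\<sigma> i) 1) \<in> \<int>"
  using assms by (intro det_in_Ints) (auto simp: lattice_frame_def int_vecs_def axis_def)

lemma frame_height_pos:
  assumes "lattice_frame L b"
  shows "frame_height L b > 0"
proof -
  obtain \<sigma> where "frame_det L b (\<lambda>i. axis (\<sigma> i) 1) \<noteq> 0"
    using indep_on_completion[of "seg (dim L)" b] assms by (auto simp: lattice_frame_def)
  then show ?thesis unfolding frame_height_def by (intro sum_pos2[of _ \<sigma>]) auto
qed

text \<open>
  Two frames of the same subspace have proportional determinants, so a frame that is minimal for one norm is
  minimal for every single determinant. Such a frame plays the role of a basis of the integer vectors in \<open>L\<close>.
\<close>

lemma minimal_frame_exists: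
  fixes L :: "(real^'k::finite) set"
  assumes L: "rational_subspace L"
  shows "\<exists>b. lattice_frame L b \<and>
    (\<forall>b' W. lattice_frame L b' \<longrightarrow> \<bar>frame_det L b W\<bar> \<le> \<bar>frame_det L b' W\<bar>)"
proof -
  have int: "real_of_int \<lfloor>frame_height L b\<rfloor> = frame_height L b" if "lattice_frame L b" for b
  proof -
    have "frame_height L b \<in> \<int>"
      unfolding frame_height_def using frame_minor_in_Ints[OF that] by (intro Ints_sum Ints_abs)
    then show ?thesis by (auto elim: Ints_cases)
  qed
  obtain b0 where "lattice_frame L b0" using lattice_frame_exists[OF L] by blast
  then obtain b where b: "lattice_frame L b"
    and least: "\<And>b'. lattice_frame L b' \<Longrightarrow> nat \<lfloor>frame_height L b\<rfloor> \<le> nat \<lfloor>frame_height L b'\<rfloor>"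
    using ex_has_least_nat[of "lattice_frame L" b0 "\<lambda>b. nat \<lfloor>frame_height L b\<rfloor>"] by blast
  have "\<bar>frame_det L b W\<bar> \<le> \<bar>frame_det L b' W\<bar>" if b': "lattice_frame L b'" for b' W
  proof -
    have "inj_on b (seg (dim L))" using b by (simp add: lattice_frame_def indep_on_def)
    moreover have "b' i \<in> span (b ` seg (dim L))" if "i \<in> seg (dim L)" for i
      using b' that by (auto simp: span_lattice_frame[OF L b] lattice_frame_def)
    ultimately obtain c where c: "\<And>W. frame_det L b' W = c * frame_det L b W"
      using partial_rows_change_of_basis by blast
    have "frame_height L b' = \<bar>c\<bar> * frame_height L b"
      by (simp add: frame_height_def c abs_mult sum_distrib_left)
    moreover have "frame_height L b \<le> frame_height L b'"
      using least[OF b'] int[OF b] int[OF b'] frame_height_pos[OF b] frame_height_pos[OF b']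
      by (simp add: nat_le_eq_zle flip: of_int_le_iff[where 'a = real])
    ultimately have "1 \<le> \<bar>c\<bar>" using frame_height_pos[OF b] by simp
    then show ?thesis by (simp add: c abs_mult mult_le_cancel_right1)
  qed
  then show ?thesis using b by blast
qed

definition min_frame :: "(real^'k::finite) set \<Rightarrow> ('k \<Rightarrow> real^'k)" where
  "min_frame L = (SOME b. lattice_frame L b \<and>
    (\<forall>b' W. lattice_frame L b' \<longrightarrow> \<bar>frame_det L b W\<bar> \<le> \<bar>frame_det L b' W\<bar>))"

lemma
  assumes "rational_subspace L"
  shows lattice_frame_min_frame: "lattice_frame L (min_frame L)"
    and min_frame_le: "lattice_frame L b' \<Longrightarrow> \<bar>frame_det L (min_frame L) W\<bar> \<le> \<bar>frame_det L b' W\<bar>"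
  using someI_ex[OF minimal_frame_exists[OF assms]] unfolding min_frame_def by blast+

text \<open>
  A minimal frame of \<open>M\<close> together with \<open>v\<close> is a frame of the span of \<open>M\<close> and \<open>v\<close>, and the minimal frame of this
  span does no worse. This takes the place of the submultiplicativity of covolumes.
\<close>

lemma frame_det_extend:
  fixes M :: "(real^'k::finite) set"
  assumes M: "rational_subspace M" and v: "v \<in> int_vecs" "v \<notin> M"
  defines "L \<equiv> span (insert v M)"
  obtains i where "i \<notin> seg (dim M)" "seg (dim L) = insert i (seg (dim M))"
    "\<And>W. \<bar>frame_det L (min_frame L) W\<bar> \<le> \<bar>frame_det M (min_frame M) (W(i := v))\<bar>"
proof -
  have spanM: "span M = M" using subspace_rational[OF M] by (simp add: span_eq_iff)
  have dimL: "dim L = Suc (dim M)" unfolding L_def dim_span dim_insert spanM using v(2) by simp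
  then have "dim M < CARD('k)" using dim_le_CARD[of L] by simp
  then obtain i :: 'k where i: "i \<notin> seg (dim M)" "seg (Suc (dim M)) = insert i (seg (dim M))"
    using seg_Suc by blast
  let ?b = "(min_frame M)(i := v)"
  note fM = lattice_frame_min_frame[OF M]
  have im: "?b ` seg (dim L) = insert v (min_frame M ` seg (dim M))"
    using i by (auto simp: dimL)
  have "min_frame M ` seg (dim M) \<subseteq> M \<inter> int_vecs" using fM by (simp add: lattice_frame_def)
  then have "?b ` seg (dim L) \<subseteq> L \<inter> int_vecs"
    unfolding im using v(1) span_superset[of "insert v M"] by (auto simp: L_def)
  moreover have "indep_on (seg (dim L)) ?b"
    unfolding dimL i(2) using fM v(2) i(1) span_lattice_frame[OF M fM]
    by (intro indep_on_insert) (auto simp: lattice_frame_def)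
  ultimately have "lattice_frame L ?b" by (simp add: lattice_frame_def)
  moreover have "rational_subspace L" unfolding L_def by (rule rational_subspace_extend[OF M v(1)])
  ultimately have "\<bar>frame_det L (min_frame L) W\<bar> \<le> \<bar>frame_det L ?b W\<bar>" for W
    by (intro min_frame_le)
  moreover have "partial_rows (seg (dim L)) ?b W
      = partial_rows (seg (dim M)) (min_frame M) (W(i := v))" for W
    using i by (auto simp: vec_eq_iff dimL)
  ultimately have "\<bar>frame_det L (min_frame L) W\<bar> \<le> \<bar>frame_det M (min_frame M) (W(i := v))\<bar>" for W
    by simp
  moreover have "seg (dim L) = insert i (seg (dim M))" unfolding dimL by (rule i(2))
  ultimately show thesis using i(1) by (intro that)
qed

section \<open>Covolumes of deformed lattices\<close>

text \<open>
  The entry \<open>\<sigma> i\<close> names the coordinate axis in row \<open>i\<close>, for \<open>i\<close> outside \<open>J\<close>. As \<open>\<sigma>\<close> varies, these are the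
  Pluecker coordinates of the rows in \<open>J\<close>, up to sign and repetition, and zeros where an axis is repeated.
\<close>

abbreviation minor :: "'k set \<Rightarrow> ('k \<Rightarrow> real^'k) \<Rightarrow> ('k \<Rightarrow> 'k) \<Rightarrow> real" where
  "minor J b \<sigma> \<equiv> det (partial_rows J b (\<lambda>i::'k::finite. axis (\<sigma> i) 1))"

text \<open>
  The deformation of the lattice that belongs to \<open>t\<close> and \<open>y\<close> has determinant \<open>1\<close>, and its inverse maps the axis
  \<open>e\<^sub>s\<close> to \<open>weight t s\<close> times this vector. Hence a determinant whose rows are deformed frame vectors and axes
  \<open>e\<^sub>s\<close> equals the determinant of the original frame vectors and these vectors, times the weights.
\<close>

definition sheared_axis :: "real^'n \<Rightarrow> 'n::finite option \<Rightarrow> real^('n option)" where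
  "sheared_axis y s = axis s 1 + (case s of None \<Rightarrow> 0 | Some j \<Rightarrow> - y $ j) *s axis None 1"

text \<open>
  The coordinates of the deformed vector \<open>v\<close> are these numbers divided by the weights.
\<close>

definition sheared_coord :: "real^'n \<Rightarrow> real^('n option) \<Rightarrow> 'n::finite option \<Rightarrow> real" where
  "sheared_coord y v s = v $ s + (case s of None \<Rightarrow> \<Sum>j\<in>UNIV. y $ j * v $ Some j | Some j \<Rightarrow> 0)"

definition weight :: "real^('n option) \<Rightarrow> 'n::finite option \<Rightarrow> real" where
  "weight t s = (case s of None \<Rightarrow> exp (- t $ None) | Some j \<Rightarrow> exp (t $ Some j))"

definition covol_term ::
  "real^('n option) \<Rightarrow> (real^('n option)) set \<Rightarrow> ('n option \<Rightarrow> 'n option) \<Rightarrow> real^'n \<Rightarrow> real" where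
  "covol_term t L \<sigma> y = (\<Prod>i\<in>- seg (dim L). weight t (\<sigma> i))
      * \<bar>frame_det L (min_frame L) (\<lambda>i. sheared_axis y (\<sigma> i))\<bar>"

text \<open>
  The maximum norm of the multivector of the deformed minimal frame, that is, up to bounded factors the
  covolume of the deformed lattice in \<open>L\<close>.
\<close>

definition covol :: "real^('n option) \<Rightarrow> (real^('n::finite option)) set \<Rightarrow> real^'n \<Rightarrow> real" where
  "covol t L y = Max (range (\<lambda>\<sigma>. covol_term t L \<sigma> y))"

lemma weight_pos: "weight t s > 0"
  by (simp add: weight_def split: option.split)

lemma sum_option: "(\<Sum>s\<in>UNIV. g s) = g None + (\<Sum>j\<in>UNIV. g (Some j))"
  for g :: "'n::finite option \<Rightarrow> 'a::comm_monoid_add"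
  by (simp add: UNIV_option_conv sum.reindex)

lemma prod_option: "(\<Prod>s\<in>UNIV. g s) = g None * (\<Prod>j\<in>UNIV. g (Some j))"
  for g :: "'n::finite option \<Rightarrow> 'a::comm_monoid_mult"
  by (simp add: UNIV_option_conv prod.reindex)

lemma sheared_expansion:
  "v = (\<Sum>s\<in>UNIV. sheared_coord y v s *s sheared_axis y s)"
proof -
  have "(\<Sum>s\<in>UNIV. sheared_coord y v s *s sheared_axis y s) $ r = v $ r" for r
    by (cases r)
      (simp_all add: sum_option sheared_coord_def sheared_axis_def axis_def sum.distrib
        sum_subtractf sum_negf algebra_simps if_distrib cong: if_cong)
  then show ?thesis by (simp add: vec_eq_iff)
qed

lemma covol_term_nonneg: "0 \<le> covol_term t L \<sigma> y"
  unfolding covol_term_def by (intro mult_nonneg_nonneg prod_nonneg) (auto intro: less_imp_le[OF weight_pos])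

lemma covol_term_le: "covol_term t L \<sigma> y \<le> covol t L y"
  unfolding covol_def by (rule Max_ge) auto

lemma covol_leI: "(\<And>\<sigma>. covol_term t L \<sigma> y \<le> c) \<Longrightarrow> covol t L y \<le> c"
  unfolding covol_def by (subst Max_le_iff) auto

lemma covol_nonneg: "0 \<le> covol t L y"
  using covol_term_nonneg covol_term_le order_trans by blast

text \<open>
  Expand the row \<open>v\<close> in the sheared axes: each of the \<open>n + 1\<close> summands is a coordinate of the multivector of
  \<open>M\<close> times a coordinate of the deformed \<open>v\<close>, and the hypothesis bounds the latter by \<open>\<delta>\<close>.
\<close>

lemma covol_extend:
  fixes M :: "(real^('n::finite option)) set" and \<delta> :: real
  assumes M: "rational_subspace M" and v: "v \<in> int_vecs" "v \<notin> M"
    and short: "\<And>s. \<bar>sheared_coord y v s\<bar> \<le> \<delta> * weight t s"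
  shows "covol t (span (insert v M)) y \<le> real CARD('n option) * \<delta> * covol t M y"
proof (rule covol_leI)
  fix \<sigma> :: "'n option \<Rightarrow> 'n option"
  define L where "L = span (insert v M)"
  let ?b = "min_frame M" and ?W = "\<lambda>i. sheared_axis y (\<sigma> i)"
  obtain i where i: "i \<notin> seg (dim M)" "seg (dim L) = insert i (seg (dim M))"
    "\<And>W. \<bar>frame_det L (min_frame L) W\<bar> \<le> \<bar>frame_det M ?b (W(i := v))\<bar>"
    using frame_det_extend[OF M v, folded L_def] by blast
  let ?P = "\<Prod>l\<in>- seg (dim L). weight t (\<sigma> l)"
  let ?d = "\<lambda>s. frame_det M ?b (\<lambda>l. sheared_axis y ((\<sigma>(i := s)) l))"
  have P0: "0 \<le> ?P" by (intro prod_nonneg) (auto intro: less_imp_le[OF weight_pos])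
  have upd: "partial_rows (seg (dim M)) ?b (?W(i := u))
      = (\<chi> l. if l = i then u else partial_rows (seg (dim M)) ?b ?W $ l)" for u
    using i(1) by (auto simp: vec_eq_iff)
  have "frame_det M ?b (?W(i := v))
      = (\<Sum>s\<in>UNIV. sheared_coord y v s * frame_det M ?b (?W(i := sheared_axis y s)))"
    unfolding upd by (subst sheared_expansion[of v y]) (simp add: det_row_combination)
  also have "\<dots> = (\<Sum>s\<in>UNIV. sheared_coord y v s * ?d s)"
    by (intro sum.cong refl arg_cong2[where f = "(*)"] arg_cong[where f = det])
      (auto simp: vec_eq_iff)
  finally have expand: "frame_det M ?b (?W(i := v)) = (\<Sum>s\<in>UNIV. sheared_coord y v s * ?d s)" .
  have prod_upd: "(\<Prod>l\<in>- seg (dim M). weight t ((\<sigma>(i := s)) l)) = weight t s * ?P" for s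
  proof -
    have "- seg (dim M) = insert i (- seg (dim L))" using i by auto
    then have "(\<Prod>l\<in>- seg (dim M). weight t ((\<sigma>(i := s)) l))
        = weight t s * (\<Prod>l\<in>- seg (dim L). weight t ((\<sigma>(i := s)) l))"
      using i(2) by simp
    also have "(\<Prod>l\<in>- seg (dim L). weight t ((\<sigma>(i := s)) l)) = ?P"
      using i(2) by (intro prod.cong) auto
    finally show ?thesis .
  qed
  have "covol_term t L \<sigma> y \<le> ?P * \<bar>frame_det M ?b (?W(i := v))\<bar>"
    unfolding covol_term_def by (intro mult_left_mono i(3) P0)
  also have "\<dots> \<le> ?P * (\<Sum>s\<in>UNIV. \<bar>sheared_coord y v s * ?d s\<bar>)"
    unfolding expand by (intro mult_left_mono sum_abs P0)
  also have "\<dots> = (\<Sum>s\<in>UNIV. ?P * (\<bar>sheared_coord y v s\<bar> * \<bar>?d s\<bar>))"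
    by (simp add: sum_distrib_left abs_mult)
  also have "\<dots> \<le> (\<Sum>s\<in>(UNIV :: 'n option set). \<delta> * covol t M y)"
  proof (rule sum_mono)
    fix s
    have "0 \<le> \<delta> * weight t s" using short[of s] by linarith
    then have \<delta>: "0 \<le> \<delta>" using weight_pos[of t s] by (simp add: zero_le_mult_iff)
    have "?P * (\<bar>sheared_coord y v s\<bar> * \<bar>?d s\<bar>) \<le> ?P * ((\<delta> * weight t s) * \<bar>?d s\<bar>)"
      by (intro mult_left_mono mult_right_mono short P0) auto
    also have "\<dots> = \<delta> * covol_term t M (\<sigma>(i := s)) y"
      unfolding covol_term_def prod_upd by simp
    also have "\<dots> \<le> \<delta> * covol t M y" by (intro mult_left_mono covol_term_le \<delta>)
    finally show "?P * (\<bar>sheared_coord y v s\<bar> * \<bar>?d s\<bar>) \<le> \<delta> * covol t M y" .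
  qed
  finally show "covol_term t (span (insert v M)) \<sigma> y \<le> real CARD('n option) * \<delta> * covol t M y"
    by (simp add: L_def)
qed

text \<open>
  Passing from axes to sheared axes is a rank one update with the axis \<open>None\<close>.
\<close>

lemma det_sheared_rows:
  "det (partial_rows J b (\<lambda>i. sheared_axis y (\<sigma> i)))
    = minor J b \<sigma> + (\<Sum>j\<in>UNIV. - (\<Sum>k | k \<notin> J \<and> \<sigma> k = Some j. minor J b (\<sigma>(k := None))) * y $ j)"
proof -
  define a where "a k = (if k \<in> J then 0 else case \<sigma> k of None \<Rightarrow> 0 | Some j \<Rightarrow> - y $ j)" for k
  let ?r = "\<lambda>i. if i \<in> J then b i else axis (\<sigma> i) 1"
  have "partial_rows J b (\<lambda>i. sheared_axis y (\<sigma> i)) = (\<chi> i. ?r i + a i *s axis None 1)"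
    by (auto simp: vec_eq_iff a_def sheared_axis_def)
  then have "det (partial_rows J b (\<lambda>i. sheared_axis y (\<sigma> i)))
      = minor J b \<sigma> + (\<Sum>k\<in>UNIV. a k * det (\<chi> i. if i = k then axis None 1 else ?r i))"
    by (simp only: det_rank_one_update)
  also have "(\<Sum>k\<in>UNIV. a k * det (\<chi> i. if i = k then axis None 1 else ?r i))
      = (\<Sum>k\<in>UNIV. a k * minor J b (\<sigma>(k := None)))"
  proof (intro sum.cong refl)
    fix k
    show "a k * det (\<chi> i. if i = k then axis None 1 else ?r i) = a k * minor J b (\<sigma>(k := None))"
    proof (cases "k \<in> J")
      case False
      then have "(\<chi> i. if i = k then axis None 1 else ?r i)
          = partial_rows J b (\<lambda>i. axis ((\<sigma>(k := None)) i) 1)"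
        by (auto simp: vec_eq_iff)
      then show ?thesis by simp
    qed (simp add: a_def)
  qed
  also have "\<dots> = (\<Sum>k\<in>UNIV. \<Sum>j\<in>UNIV. (if k \<notin> J \<and> \<sigma> k = Some j then - minor J b (\<sigma>(k := None)) * y $ j else 0))"
  proof (intro sum.cong refl)
    fix k
    show "a k * minor J b (\<sigma>(k := None))
        = (\<Sum>j\<in>UNIV. (if k \<notin> J \<and> \<sigma> k = Some j then - minor J b (\<sigma>(k := None)) * y $ j else 0))"
      by (cases "k \<in> J"; cases "\<sigma> k") (simp_all add: a_def)
  qed
  also have "\<dots> = (\<Sum>j\<in>UNIV. \<Sum>k | k \<notin> J \<and> \<sigma> k = Some j. - minor J b (\<sigma>(k := None)) * y $ j)"
    by (subst sum.swap) (simp add: sum.If_cases)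
  finally show ?thesis by (simp add: sum_distrib_right sum_negf)
qed

section \<open>Lower bounds for covolumes\<close>

lemma minor_non_inj:
  assumes "i \<notin> J" "k \<notin> J" "i \<noteq> k" "\<sigma> i = \<sigma> k"
  shows "minor J b \<sigma> = 0"
  using assms by (intro det_identical_rows[of i k]) (auto simp: row_def vec_eq_iff)

lemma abs_minor_empty_le: "\<bar>minor {} b \<sigma>\<bar> \<le> 1"
proof (cases "inj \<sigma>")
  case True
  then have p: "\<sigma> permutes UNIV"
    by (intro bij_imp_permutes) (auto simp: bij_def finite_UNIV_inj_surj)
  have "(\<chi> i. axis (\<sigma> i) 1) = (\<chi> i. (mat 1 :: real^'a^'a) $ \<sigma> i)"
    by (auto simp: vec_eq_iff axis_def mat_def)
  then have "minor {} b \<sigma> = of_int (sign \<sigma>) * det (mat 1 :: real^'a^'a)"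
    using det_permute_rows[OF p, of "mat 1"] by simp
  then show ?thesis by (simp add: sign_def)
next
  case False
  then obtain i k where "i \<noteq> k" "\<sigma> i = \<sigma> k" by (auto simp: inj_def)
  then have "minor {} b \<sigma> = 0" using minor_non_inj[of i "{}" k \<sigma> b] by simp
  then show ?thesis by simp
qed

text \<open>
  For the zero subspace the coordinates are determinants of sheared axes only; the product of all weights is
  \<open>1\<close> because \<open>t $ None\<close> is the sum of the other \<open>t $ Some j\<close>.
\<close>

lemma covol_zero_le:
  fixes t :: "real^('n::finite option)"
  assumes "t \<in> a_plus"
  shows "covol t {0} y \<le> 1"
proof (rule covol_leI)
  fix \<sigma> :: "'n option \<Rightarrow> 'n option"
  have seg0: "seg (dim {0::real^('n option)}) = ({} :: 'n option set)" by (simp add: seg_def)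
  let ?b = "min_frame {0::real^('n option)}"
  have ex: "covol_term t {0} \<sigma> y = (\<Prod>i\<in>UNIV. weight t (\<sigma> i)) *
     \<bar>minor {} ?b \<sigma> + (\<Sum>j\<in>UNIV. - (\<Sum>k | \<sigma> k = Some j. minor {} ?b (\<sigma>(k := None))) * y $ j)\<bar>"
    unfolding covol_term_def seg0 using det_sheared_rows[of "{}" ?b y \<sigma>] by simp
  show "covol_term t {0} \<sigma> y \<le> 1"
  proof (cases "inj \<sigma>")
    case True
    then have "bij \<sigma>" by (simp add: bij_def finite_UNIV_inj_surj)
    then have "(\<Prod>i\<in>UNIV. weight t (\<sigma> i)) = (\<Prod>s\<in>UNIV. weight t s)"
      by (rule prod.reindex_bij_betw)
    also have "\<dots> = 1"
      using assms by (simp add: prod_option weight_def a_plus_def exp_minus flip: exp_sum)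
    finally have w: "(\<Prod>i\<in>UNIV. weight t (\<sigma> i)) = 1" .
    have "minor {} ?b (\<sigma>(k := None)) = 0" if "\<sigma> k = Some j" for k j
    proof -
      obtain i where "None = \<sigma> i" by (rule surjE[OF bij_is_surj[OF \<open>bij \<sigma>\<close>]])
      then have "\<sigma> i = None" by (rule sym)
      then have "i \<noteq> k" "(\<sigma>(k := None)) i = (\<sigma>(k := None)) k" using that by auto
      then show ?thesis by (intro minor_non_inj[of i "{}" k]) simp_all
    qed
    then have "covol_term t {0} \<sigma> y = \<bar>minor {} ?b \<sigma>\<bar>"
      unfolding ex w by simp
    then show ?thesis by (simp only: abs_minor_empty_le)
  next
    case False
    then obtain i k where "i \<noteq> k" "\<sigma> i = \<sigma> k" by (auto simp: inj_def)
    then have "frame_det {0} ?b (\<lambda>i. sheared_axis y (\<sigma> i)) = 0"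
      unfolding seg0 by (intro det_identical_rows[of i k]) (auto simp: row_def vec_eq_iff)
    then show ?thesis by (simp add: covol_term_def)
  qed
qed

lemma weight_prod_ge:
  assumes t: "t \<in> a_plus" and none: "\<And>i. i \<in> I \<Longrightarrow> \<sigma> i \<noteq> None"
  shows "1 \<le> (\<Prod>i\<in>I. weight t (\<sigma> i))"
    and "finite I \<Longrightarrow> i \<in> I \<Longrightarrow> weight t (\<sigma> i) \<le> (\<Prod>i\<in>I. weight t (\<sigma> i))"
proof -
  have ge1: "1 \<le> weight t (\<sigma> i)" if "i \<in> I" for i
    using t none[OF that] by (auto simp: a_plus_def weight_def less_imp_le)
  then show "1 \<le> (\<Prod>i\<in>I. weight t (\<sigma> i))" by (intro prod_ge_1) auto
  assume "finite I" "i \<in> I"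
  then have "(\<Prod>i\<in>I. weight t (\<sigma> i)) = weight t (\<sigma> i) * (\<Prod>i\<in>I - {i}. weight t (\<sigma> i))"
    by (rule prod.remove)
  moreover have "1 \<le> (\<Prod>i\<in>I - {i}. weight t (\<sigma> i))" using ge1 by (intro prod_ge_1) auto
  ultimately show "weight t (\<sigma> i) \<le> (\<Prod>i\<in>I. weight t (\<sigma> i))"
    using weight_pos[of t "\<sigma> i"] by simp
qed

text \<open>
  The minors of an integer frame are integers, so a nonzero one is at least \<open>1\<close> in absolute value. There are
  two cases. If all minors that use the axis \<open>None\<close> vanish, the coordinate of any nonzero minor is constant in
  \<open>y\<close> and its weights are at least \<open>1\<close>. Otherwise take a nonzero minor that uses the axis \<open>None\<close> and replace
  this axis by another one: the minor becomes a coefficient of the resulting affine function, whose absolute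
  value then reaches \<open>\<kappa>\<close> on \<open>A\<close>. Since \<open>L\<close> is nonzero, the new axis can be chosen such that the axis
  \<open>Some l0\<close>, whose weight compensates for \<open>\<kappa>\<close>, is among those used.
\<close>

proposition covol_lower_bound:
  fixes L :: "(real^('n::finite option)) set" and f :: "'a \<Rightarrow> real^'n"
  assumes L: "rational_subspace L" "L \<noteq> {0}" and t: "t \<in> a_plus"
    and A: "A \<noteq> {}" and \<kappa>: "\<And>c0 c. (\<exists>j. 1 \<le> \<bar>c $ j\<bar>) \<Longrightarrow> \<exists>x\<in>A. \<kappa> \<le> \<bar>c0 + (\<Sum>j\<in>UNIV. c $ j * f x $ j)\<bar>"
    and big: "1 \<le> exp (t $ Some l0) * \<kappa>"
  shows "\<exists>x\<in>A. 1 \<le> covol t L (f x)"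
proof -
  define J :: "'n option set" where "J = seg (dim L)"
  let ?b = "min_frame L"
  have frame: "lattice_frame L ?b" by (rule lattice_frame_min_frame[OF L(1)])
  have term_eq: "covol_term t L \<sigma> y = (\<Prod>i\<in>- J. weight t (\<sigma> i)) *
     \<bar>minor J ?b \<sigma> + (\<Sum>j\<in>UNIV. (\<chi> j. - (\<Sum>k | k \<notin> J \<and> \<sigma> k = Some j. minor J ?b (\<sigma>(k := None)))) $ j * y $ j)\<bar>"
    for \<sigma> y
    unfolding covol_term_def J_def using det_sheared_rows[of "seg (dim L)" ?b y \<sigma>] by simp
  have minor_ge: "1 \<le> \<bar>minor J ?b \<sigma>\<bar>" if "minor J ?b \<sigma> \<noteq> 0" for \<sigma>
    using frame_minor_in_Ints[OF frame, of \<sigma>] that Ints_nonzero_abs_ge1 by (auto simp: J_def)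
  have "\<exists>\<sigma>. \<exists>x\<in>A. 1 \<le> covol_term t L \<sigma> (f x)"
  proof (cases "\<exists>\<sigma> i. i \<notin> J \<and> \<sigma> i = None \<and> minor J ?b \<sigma> \<noteq> 0")
    case True
    then obtain \<sigma> i where \<sigma>: "i \<notin> J" "\<sigma> i = None" "minor J ?b \<sigma> \<noteq> 0" by blast
    \<comment> \<open>A repeated axis would give two equal rows.\<close>
    have inj: "k = l" if "k \<notin> J" "l \<notin> J" "\<sigma> k = \<sigma> l" for k l
      using minor_non_inj[of k J l \<sigma> ?b] that \<sigma>(3) by blast
    have "\<exists>l. Some l \<notin> \<sigma> ` (- J) \<and> Some l0 \<in> insert (Some l) (\<sigma> ` (- J))"
    proof (cases "Some l0 \<in> \<sigma> ` (- J)")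
      case True
      have "dim L \<noteq> 0" using L(2) subspace_rational[OF L(1)] subspace_0 by (auto simp: dim_eq_0)
      then have "card J \<noteq> 0" using card_seg[OF dim_le_CARD[of L]] by (simp add: J_def)
      then have "J \<noteq> {}" by auto
      then have "card (- J) < CARD('n option)" by (intro psubset_card_mono) auto
      then have "card (\<sigma> ` (- J)) < CARD('n option)"
        using card_image_le[of "- J" \<sigma>] by simp
      then have "\<sigma> ` (- J) \<noteq> UNIV" by auto
      then obtain s where s: "s \<notin> \<sigma> ` (- J)" by blast
      have "None \<in> \<sigma> ` (- J)" using \<sigma>(1,2) by (metis ComplI image_eqI)
      then obtain l where "s = Some l" using s by (cases s) auto
      then show ?thesis using True s by blast
    qed auto
    then obtain l where l: "Some l \<notin> \<sigma> ` (- J)" "Some l0 \<in> insert (Some l) (\<sigma> ` (- J))" by blast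
    define \<sigma>' where "\<sigma>' = \<sigma>(i := Some l)"
    define c where "c = (\<chi> j. - (\<Sum>k | k \<notin> J \<and> \<sigma>' k = Some j. minor J ?b (\<sigma>'(k := None))))"
    have "\<sigma> k \<noteq> Some l" if "k \<notin> J" for k using l(1) that by (metis ComplI image_eqI)
    then have "{k. k \<notin> J \<and> \<sigma>' k = Some l} = {i}"
      using \<sigma>(1) by (auto simp: \<sigma>'_def split: if_splits)
    then have "c $ l = - minor J ?b (\<sigma>'(i := None))"
      unfolding c_def by (simp only: vec_lambda_beta) simp
    moreover have "\<sigma>'(i := None) = \<sigma>" using \<sigma>(2) by (auto simp: \<sigma>'_def)
    ultimately have "1 \<le> \<bar>c $ l\<bar>" using minor_ge[OF \<sigma>(3)] by (simp only: abs_minus_cancel)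
    then obtain x where x: "x \<in> A" "\<kappa> \<le> \<bar>minor J ?b \<sigma>' + (\<Sum>j\<in>UNIV. c $ j * f x $ j)\<bar>"
      using \<kappa> by blast
    have none: "\<sigma>' k \<noteq> None" if "k \<in> - J" for k
      using inj[of k i] that \<sigma>(1,2) by (auto simp: \<sigma>'_def)
    have "Some l0 \<in> \<sigma>' ` (- J)"
    proof (cases "l0 = l")
      case True
      then show ?thesis using \<sigma>(1) by (intro image_eqI[of _ _ i]) (auto simp: \<sigma>'_def)
    next
      case False
      then obtain k where k: "k \<in> - J" "\<sigma> k = Some l0" using l(2) by auto
      then have "k \<noteq> i" using \<sigma>(2) by auto
      then show ?thesis using k by (intro image_eqI[of _ _ k]) (auto simp: \<sigma>'_def)
    qed
    then obtain k where k: "k \<in> - J" "\<sigma>' k = Some l0" by auto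
    have "weight t (\<sigma>' k) \<le> (\<Prod>i\<in>- J. weight t (\<sigma>' i))"
      using weight_prod_ge(2)[OF t, of "- J" \<sigma>' k] none k by auto
    then have w: "exp (t $ Some l0) \<le> (\<Prod>i\<in>- J. weight t (\<sigma>' i))"
      by (simp add: k(2) weight_def)
    have "0 < exp (t $ Some l0) * \<kappa>" using big by linarith
    then have "0 \<le> \<kappa>" by (simp add: zero_less_mult_iff)
    then have "exp (t $ Some l0) * \<kappa> \<le> covol_term t L \<sigma>' (f x)"
      unfolding term_eq c_def[symmetric] using w x(2) by (intro mult_mono) (auto intro: order_trans[OF less_imp_le[OF exp_gt_zero]])
    then show ?thesis using big x(1) by (meson order_trans)
  next
    case False
    obtain \<sigma> where \<sigma>: "minor J ?b \<sigma> \<noteq> 0"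
      using indep_on_completion[of J ?b] frame by (auto simp: lattice_frame_def J_def)
    obtain x where x: "x \<in> A" using A by blast
    have none: "\<sigma> k \<noteq> None" if "k \<in> - J" for k using False \<sigma> that by auto
    have zero: "minor J ?b \<tau> = 0" if "k \<notin> J" "\<tau> k = None" for \<tau> k
      using False that by blast
    have "minor J ?b (\<sigma>(k := None)) = 0" if "k \<notin> J" for k
      by (rule zero[OF that]) simp
    then have "covol_term t L \<sigma> (f x) = (\<Prod>i\<in>- J. weight t (\<sigma> i)) * \<bar>minor J ?b \<sigma>\<bar>"
      unfolding term_eq by simp
    moreover have "1 \<le> (\<Prod>i\<in>- J. weight t (\<sigma> i))"
      using weight_prod_ge(1)[OF t, of "- J" \<sigma>] none by auto
    ultimately have "1 * 1 \<le> covol_term t L \<sigma> (f x)"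
      using minor_ge[OF \<sigma>] by (simp only:) (intro mult_mono, auto)
    then show ?thesis using x by auto
  qed
  then obtain \<sigma> x where "x \<in> A" "1 \<le> covol_term t L \<sigma> (f x)" by blast
  then show ?thesis using covol_term_le[of t L \<sigma> "f x"] by force
qed

section \<open>Covolumes along a good and nonplanar map\<close>

text \<open>
  Linear independence bounds the suprema of affine combinations away from zero on the compact unit sphere of
  coefficients, and homogeneity extends this to all large coefficients.
\<close>

lemma uniform_nonplanarity:
  fixes f :: "'a \<Rightarrow> real^'n"
  assumes indep: "\<And>c0 c. (\<forall>y\<in>A. c0 + (\<Sum>i\<in>UNIV. c $ i * f y $ i) = 0) \<Longrightarrow> c0 = 0 \<and> (\<forall>i. c $ i = 0)"
  obtains \<kappa> where "\<kappa> > 0"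
    "\<And>c0 c. (\<exists>j. 1 \<le> \<bar>c $ j\<bar>) \<Longrightarrow> \<exists>y\<in>A. \<kappa> \<le> \<bar>c0 + (\<Sum>i\<in>UNIV. c $ i * f y $ i)\<bar>"
proof -
  define g :: "'a \<Rightarrow> real \<times> (real^'n) \<Rightarrow> real"
    where "g y p = \<bar>fst p + (\<Sum>i\<in>UNIV. snd p $ i * f y $ i)\<bar>" for y p
  define S :: "(real \<times> (real^'n)) set" where "S = sphere 0 1"
  define W where "W m = (\<Union>y\<in>A. {p. 1 / real (Suc m) < g y p})" for m
  have "open (W m)" for m
    unfolding W_def g_def by (intro open_UN ballI open_Collect_less continuous_intros)
  moreover have "S \<subseteq> (\<Union>m. W m)"
  proof
    fix p assume "p \<in> S"
    then have "p \<noteq> 0" by (auto simp: S_def)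
    then have "\<not> (fst p = 0 \<and> (\<forall>i. snd p $ i = 0))" by (auto simp: prod_eq_iff vec_eq_iff)
    then obtain y where "y \<in> A" "fst p + (\<Sum>i\<in>UNIV. snd p $ i * f y $ i) \<noteq> 0"
      using indep[where ?c0.0 = "fst p" and c = "snd p"] by blast
    then have "y \<in> A" "0 < g y p" by (auto simp: g_def)
    then obtain m where "1 / real (Suc m) < g y p" using reals_Archimedean[of "g y p"] by (auto simp: inverse_eq_divide)
    then show "p \<in> (\<Union>m. W m)" using \<open>y \<in> A\<close> by (auto simp: W_def)
  qed
  ultimately obtain F where F: "finite F" "S \<subseteq> (\<Union>m\<in>F. W m)"
    using compactE_image[of S UNIV W] by (auto simp: S_def)
  define N where "N = Max (insert 0 F)"
  have "\<exists>y\<in>A. 1 / real (Suc N) \<le> g y (c0, c)" if j: "\<exists>j. 1 \<le> \<bar>c $ j\<bar>" for c0 c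
  proof -
    obtain j where "1 \<le> \<bar>c $ j\<bar>" using j by blast
    also have "\<dots> \<le> norm c" by (rule component_le_norm_cart)
    also have "\<dots> \<le> norm (c0, c)" using norm_snd_le[of c c0] by simp
    finally have r: "1 \<le> norm (c0, c)" .
    then have nz: "(c0, c) \<noteq> 0" by (metis norm_zero not_one_le_zero)
    let ?r = "norm (c0, c)"
    have "norm ((1 / ?r) *\<^sub>R (c0, c)) = 1" 
      using r nz by (simp only: norm_scaleR) simp
    then have "(1 / ?r) *\<^sub>R (c0, c) \<in> S" by (simp only: S_def mem_sphere dist_0_norm)
    then obtain m y where m: "m \<in> F" "y \<in> A" "1 / real (Suc m) < g y ((1 / ?r) *\<^sub>R (c0, c))"
      using F(2) by (auto simp: W_def)
    have "m \<le> N" using m(1) F(1) by (simp add: N_def)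
    then have "1 / real (Suc N) \<le> 1 / real (Suc m)" by (simp add: frac_le)
    also have "\<dots> \<le> g y ((1 / ?r) *\<^sub>R (c0, c))" using m(3) by simp
    also have "\<dots> = g y (c0, c) / ?r"
    proof -
      have "c0 / ?r + (\<Sum>i\<in>UNIV. c $ i / ?r * f y $ i) = (c0 + (\<Sum>i\<in>UNIV. c $ i * f y $ i)) / ?r"
        by (simp add: add_divide_distrib sum_divide_distrib)
      then show ?thesis by (simp add: g_def)
    qed
    also have "\<dots> \<le> g y (c0, c)"
    proof -
      have "0 \<le> g y (c0, c)" by (simp add: g_def)
      then have "g y (c0, c) * 1 \<le> g y (c0, c) * ?r" using r by (intro mult_left_mono) auto
      then show ?thesis using r by (subst pos_divide_le_eq) auto
    qed
    finally show ?thesis using m(2) by blast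
  qed
  then show thesis using that[of "1 / real (Suc N)"] by (simp add: g_def)
qed

lemma good_factor_antimono:
  assumes "C > 0" "\<alpha> > 0" "N \<le> N'"
  shows "good_factor C \<alpha> \<eta> N' \<le> good_factor C \<alpha> \<eta> N"
proof (cases "N = 0")
  case False
  then have N': "N' \<noteq> 0" using assms(3) by auto
  have le: "ennreal \<eta> / N' \<le> ennreal \<eta> / N"
  proof (cases "N = top")
    case True
    then show ?thesis using assms(3) by (simp add: top_unique)
  next
    case fin: False
    have "ennreal \<eta> = N * (ennreal \<eta> / N)"
      using False fin by (simp add: ennreal_times_divide mult.commute[of N] ennreal_mult_divide_eq)
    also have "\<dots> \<le> N' * (ennreal \<eta> / N)" by (intro mult_right_mono assms(3)) simp
    finally show ?thesis using N' by (intro divide_le_posI_ennreal) (auto simp: zero_less_iff_neq_zero)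
  qed
  have "ennreal \<eta> / N < \<infinity>" using False by (simp add: ennreal_divide_eq_top_iff less_top[symmetric])
  then have "enn2real (ennreal \<eta> / N') \<le> enn2real (ennreal \<eta> / N)"
    using le by (intro enn2real_mono) auto
  then have "enn2real (ennreal \<eta> / N') powr \<alpha> \<le> enn2real (ennreal \<eta> / N) powr \<alpha>"
    using assms by (intro powr_mono2) auto
  then show ?thesis
    using False N' assms by (auto simp: good_factor_def intro!: ennreal_leI mult_left_mono)
qed (simp add: good_factor_def)

lemma continuous_on_Max_image:
  fixes h :: "'i \<Rightarrow> 'a::topological_space \<Rightarrow> real"
  assumes "finite I" "I \<noteq> {}" "\<And>i. i \<in> I \<Longrightarrow> continuous_on V (h i)"
  shows "continuous_on V (\<lambda>x. Max ((\<lambda>i. h i x) ` I))"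
  using assms
proof (induction I rule: finite_ne_induct)
  case (insert i I)
  then have "continuous_on V (\<lambda>x. max (h i x) (Max ((\<lambda>i. h i x) ` I)))"
    by (intro continuous_on_max) auto
  then show ?case using insert by simp
qed simp

text \<open>
  On a given ball, the maximum has the same supremum as one of the functions, and its sublevel sets are
  contained in those of that function. So the constants do not change.
\<close>

lemma good_fun_on_Max:
  fixes h :: "'i \<Rightarrow> 'a::euclidean_space \<Rightarrow> real"
  assumes borel: "sets \<nu> = sets borel" and I: "finite I" "I \<noteq> {}" and pos: "C > 0" "\<alpha> > 0"
    and cont: "\<And>i. i \<in> I \<Longrightarrow> continuous_on V (h i)"
    and good: "\<And>i. i \<in> I \<Longrightarrow> good_fun_on C \<alpha> \<nu> V (h i)"
    and nonneg: "\<And>i x. 0 \<le> h i x"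
  shows "good_fun_on C \<alpha> \<nu> V (\<lambda>x. Max ((\<lambda>i. h i x) ` I))"
  unfolding good_fun_on_def
proof (intro ballI allI impI)
  fix x r \<eta> assume x: "x \<in> msupp \<nu>" "0 < r" "ball x r \<subseteq> V" and \<eta>: "(0::real) < \<eta>"
  let ?B = "ball x r" and ?g = "\<lambda>x. Max ((\<lambda>i. h i x) ` I)"
  have ge: "h i y \<le> ?g y" if "i \<in> I" for i y using I that by simp
  have g0: "0 \<le> ?g y" for y using I nonneg ge by (meson ex_in_conv order_trans)
  have "\<exists>i\<in>I. \<forall>k\<in>I. supnorm \<nu> ?B (h k) \<le> supnorm \<nu> ?B (h i)"
  proof -
    have "Max ((\<lambda>i. supnorm \<nu> ?B (h i)) ` I) \<in> (\<lambda>i. supnorm \<nu> ?B (h i)) ` I"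
      using I by (intro Max_in) auto
    then obtain i where "i \<in> I" "Max ((\<lambda>i. supnorm \<nu> ?B (h i)) ` I) = supnorm \<nu> ?B (h i)" by auto
    then show ?thesis using I(1) by (metis Max_ge finite_imageI imageI)
  qed
  then obtain i where i: "i \<in> I" "\<And>k. k \<in> I \<Longrightarrow> supnorm \<nu> ?B (h k) \<le> supnorm \<nu> ?B (h i)" by blast
  have "supnorm \<nu> ?B ?g \<le> supnorm \<nu> ?B (h i)"
    unfolding supnorm_def[of \<nu> ?B ?g]
  proof (rule SUP_least)
    fix y assume y: "y \<in> ?B \<inter> msupp \<nu>"
    have "?g y \<in> (\<lambda>i. h i y) ` I" using I by (intro Max_in) auto
    then obtain k where k: "k \<in> I" "?g y = h k y" by auto
    have "ennreal \<bar>h k y\<bar> \<le> supnorm \<nu> ?B (h k)" using y by (intro supnorm_ge) auto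
    also have "\<dots> \<le> supnorm \<nu> ?B (h i)" by (rule i(2)[OF k(1)])
    finally show "ennreal \<bar>?g y\<bar> \<le> supnorm \<nu> ?B (h i)" unfolding k(2) .
  qed
  then have fac: "good_factor C \<alpha> \<eta> (supnorm \<nu> ?B (h i)) \<le> good_factor C \<alpha> \<eta> (supnorm \<nu> ?B ?g)"
    by (rule good_factor_antimono[OF pos])
  have "open {y \<in> ?B. \<bar>h i y\<bar> < \<eta>}"
    using continuous_on_subset[OF cont[OF i(1)] x(3)]
    by (intro open_sublevel_within continuous_intros) auto
  then have "emeasure \<nu> {y \<in> ?B. \<bar>?g y\<bar> < \<eta>} \<le> emeasure \<nu> {y \<in> ?B. \<bar>h i y\<bar> < \<eta>}"
    using borel ge[OF i(1)] nonneg[of i] g0 by (intro emeasure_mono) (auto intro: order_le_less_trans)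
  also have "\<dots> \<le> good_factor C \<alpha> \<eta> (supnorm \<nu> ?B (h i)) * emeasure \<nu> ?B"
    using good[OF i(1)] x \<eta> by (auto simp: good_fun_on_def)
  also have "\<dots> \<le> good_factor C \<alpha> \<eta> (supnorm \<nu> ?B ?g) * emeasure \<nu> ?B"
    by (intro mult_right_mono fac) simp
  finally show "emeasure \<nu> {y \<in> ?B. \<bar>?g y\<bar> < \<eta>} \<le> good_factor C \<alpha> \<eta> (supnorm \<nu> ?B ?g) * emeasure \<nu> ?B" .
qed

lemma covol_term_affine:
  obtains c0 c where "\<And>y. covol_term t L \<sigma> y = \<bar>c0 + (\<Sum>j\<in>UNIV. c $ j * y $ j)\<bar>"
proof -
  define p where "p = (\<Prod>i\<in>- seg (dim L). weight t (\<sigma> i))"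
  have p: "0 \<le> p" unfolding p_def by (intro prod_nonneg) (auto intro: less_imp_le[OF weight_pos])
  define m where "m = minor (seg (dim L)) (min_frame L) \<sigma>"
  define c where "c = (\<chi> j. - (\<Sum>k | k \<notin> seg (dim L) \<and> \<sigma> k = Some j.
    minor (seg (dim L)) (min_frame L) (\<sigma>(k := None))))"
  have "covol_term t L \<sigma> y = \<bar>p * m + (\<Sum>j\<in>UNIV. (p *s c) $ j * y $ j)\<bar>" for y
  proof -
    have "covol_term t L \<sigma> y = p * \<bar>m + (\<Sum>j\<in>UNIV. c $ j * y $ j)\<bar>"
      unfolding covol_term_def p_def m_def c_def det_sheared_rows vec_lambda_beta ..
    also have "\<dots> = \<bar>p * (m + (\<Sum>j\<in>UNIV. c $ j * y $ j))\<bar>" using p by (simp add: abs_mult)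
    finally show ?thesis by (simp add: distrib_left sum_distrib_left mult.assoc)
  qed
  then show thesis by (rule that)
qed

lemma good_covol:
  fixes f :: "'a::euclidean_space \<Rightarrow> real^'n::finite"
  assumes borel: "sets \<nu> = sets borel" and pos: "C > 0" "\<alpha> > 0"
    and cont: "continuous_on V f" and good: "good_on C \<alpha> \<nu> V f"
  shows "continuous_on V (\<lambda>x. covol t L (f x))" "good_fun_on C \<alpha> \<nu> V (\<lambda>x. covol t L (f x))"
proof -
  have c: "continuous_on V (\<lambda>x. covol_term t L \<sigma> (f x))" for \<sigma>
  proof -
    obtain c0 c where eq: "\<And>y. covol_term t L \<sigma> y = \<bar>c0 + (\<Sum>j\<in>UNIV. c $ j * y $ j)\<bar>"
      using covol_term_affine by blast
    show ?thesis unfolding eq by (intro continuous_intros cont)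
  qed
  have g: "good_fun_on C \<alpha> \<nu> V (\<lambda>x. covol_term t L \<sigma> (f x))" for \<sigma>
  proof -
    obtain c0 c where eq: "\<And>y. covol_term t L \<sigma> y = \<bar>c0 + (\<Sum>j\<in>UNIV. c $ j * y $ j)\<bar>"
      using covol_term_affine by blast
    have "good_fun_on C \<alpha> \<nu> V (\<lambda>x. c0 + (\<Sum>j\<in>UNIV. c $ j * f x $ j))"
      using good by (simp add: good_on_def)
    then show ?thesis unfolding eq by (simp add: good_fun_on_def supnorm_def)
  qed
  show "continuous_on V (\<lambda>x. covol t L (f x))"
    unfolding covol_def using c by (intro continuous_on_Max_image) auto
  show "good_fun_on C \<alpha> \<nu> V (\<lambda>x. covol t L (f x))"
    unfolding covol_def using borel pos c g covol_term_nonneg by (intro good_fun_on_Max) auto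
qed

section \<open>Chains of subspaces and short vectors\<close>

definition comparable :: "'a set \<Rightarrow> 'a set \<Rightarrow> bool" where
  "comparable L M \<longleftrightarrow> L \<subset> M \<or> M \<subset> L"

lemma cliques_le_rational_subspaces:
  "cliques_le comparable CARD('k) {L :: (real^'k::finite) set. rational_subspace L \<and> L \<noteq> {0}}"
  unfolding cliques_le_def
proof (intro allI impI)
  fix F :: "(real^'k) set set"
  assume F: "F \<subseteq> {L. rational_subspace L \<and> L \<noteq> {0}}" "finite F \<and> pairwise comparable F"
  have "inj_on dim F"
  proof (rule inj_onI, rule ccontr)
    fix L M assume LM: "L \<in> F" "M \<in> F" "dim L = dim M" "L \<noteq> M"
    have sub: "subspace L" "subspace M" using LM F subspace_rational by auto
    have "comparable L M" using F LM by (auto simp: pairwise_def)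
    then show False
      using subspace_dim_equal[OF sub] subspace_dim_equal[OF sub(2,1)] LM
      by (auto simp: comparable_def)
  qed
  moreover have "dim ` F \<subseteq> {1..CARD('k)}"
  proof (intro image_subsetI)
    fix L assume "L \<in> F"
    then have "subspace L" "L \<noteq> {0}" using F subspace_rational by auto
    then have "dim L \<noteq> 0" using subspace_0 by (auto simp: dim_eq_0)
    then have "1 \<le> dim L" by linarith
    then show "dim L \<in> {1..CARD('k)}" using dim_le_CARD[of L] by (simp only: atLeastAtMost_iff)
  qed
  ultimately show "card F \<le> CARD('k)" using card_inj_on_le[of dim F "{1..CARD('k)}"] by simp
qed

text \<open>
  Suppose a chain \<open>F\<close> of subspaces with covolumes in \<open>[\<epsilon>, 1]\<close> is given, and every other subspace comparable with
  all of \<open>F\<close> has covolume at least \<open>1\<close>. For an integer vector \<open>v \<noteq> 0\<close> let \<open>M\<close> be the largest member of the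
  chain, extended by the zero subspace, that does not contain \<open>v\<close>. The span \<open>L\<close> of \<open>M\<close> and \<open>v\<close> belongs to the
  chain or is comparable with all of it, so its covolume is at least \<open>\<epsilon>\<close>; but if \<open>v\<close> is short, it is at
  most \<open>(n + 1) * \<delta>\<close> times the covolume of \<open>M\<close>, which is at most \<open>1\<close>.
\<close>

lemma marked_imp_no_short_vector:
  fixes t :: "real^('n::finite option)" and \<epsilon> \<delta> :: real
  assumes "marked comparable \<epsilon> (\<lambda>L. covol t L y) P"
    and "P = {L. rational_subspace L \<and> L \<noteq> {0} \<and> (\<forall>M\<in>F. comparable M L)}"
    and "finite F" "pairwise comparable F" "\<And>M. M \<in> F \<Longrightarrow> rational_subspace M"
    and "\<And>M. M \<in> F \<Longrightarrow> \<epsilon> \<le> covol t M y" "\<And>M. M \<in> F \<Longrightarrow> covol t M y \<le> 1"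
    and t: "t \<in> a_plus" and \<epsilon>: "\<epsilon> \<le> 1"
    and v: "v \<in> int_vecs" "v \<noteq> 0" and \<delta>: "0 \<le> \<delta>"
    and short: "\<And>s. \<bar>sheared_coord y v s\<bar> \<le> \<delta> * weight t s"
  shows "\<epsilon> \<le> real CARD('n option) * \<delta>"
  using assms(1-7)
proof (induction arbitrary: F rule: marked.induct)
  case (large P)
  note F = large.prems
  let ?S = "{M \<in> insert {0} F. v \<notin> M}"
  have ins: "subspace M" "rational_subspace M" if "M \<in> insert {0} F" for M
    using that F(4) subspace_rational rational_subspace_zero by auto
  have comp: "M \<subseteq> N \<or> N \<subseteq> M" if "M \<in> insert {0} F" "N \<in> insert {0} F" for M N
  proof (cases "M = {0} \<or> N = {0}")
    case True
    then show ?thesis using ins(1) that subspace_0 by auto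
  next
    case False
    then show ?thesis using that F(3) by (auto simp: pairwise_def comparable_def)
  qed
  have "finite ?S" "?S \<noteq> {}" using F(2) v(2) by auto
  then obtain M where M: "M \<in> ?S" "\<And>N. N \<in> ?S \<Longrightarrow> M \<subseteq> N \<Longrightarrow> M = N"
    using finite_has_maximal[of ?S] by blast
  define L where "L = span (insert v M)"
  have L: "rational_subspace L" "M \<subseteq> L" "v \<in> L"
    using rational_subspace_extend[OF ins(2) v(1)] M(1) span_superset[of "insert v M"]
    by (auto simp: L_def)
  have "L = N \<or> comparable N L" if N: "N \<in> F" for N
  proof (cases "v \<in> N")
    case True
    then have "M \<subseteq> N" using comp[of M N] M(1) N by auto
    then have "L \<subseteq> N" unfolding L_def using True ins(1)[of N] N by (intro span_minimal) auto
    then show ?thesis by (auto simp: comparable_def)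
  next
    case False
    then have "N \<in> ?S" using N by auto
    then have "N \<subseteq> M" using comp[of N M] M N by auto
    then show ?thesis using L False by (auto simp: comparable_def)
  qed
  then have "L \<in> F \<or> L \<in> P" using L v(2) F(1) by auto
  then have "\<epsilon> \<le> covol t L y" using F(5) large.hyps \<epsilon> by (meson order_trans)
  also have "\<dots> \<le> real CARD('n option) * \<delta> * covol t M y"
    unfolding L_def using M(1) by (intro covol_extend ins(2) v(1) short) auto
  also have "\<dots> \<le> real CARD('n option) * \<delta> * 1"
    using M(1) F(6) covol_zero_le[OF t] \<delta> by (intro mult_left_mono) auto
  finally show ?case by simp
next
  case (small L P)
  note F = small.prems
  have L: "L \<in> P" "\<epsilon> \<le> covol t L y" "covol t L y \<le> 1" by (fact small.hyps)+
  show ?case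
  proof (rule small.IH[of "insert L F"])
    show "{M \<in> P. comparable L M} =
        {M. rational_subspace M \<and> M \<noteq> {0} \<and> (\<forall>N\<in>insert L F. comparable N M)}"
      using F(1) by auto
    show "pairwise comparable (insert L F)"
    proof -
      have "comparable N L" if "N \<in> F" for N using F(1) L(1) that by blast
      then have "comparable L N \<and> comparable N L" if "N \<in> F" for N
        using that unfolding comparable_def by blast
      then show ?thesis unfolding pairwise_insert using F(3) by blast
    qed
    show "finite (insert L F)" using F(2) by simp
    show "rational_subspace M" if "M \<in> insert L F" for M using that F(1,4) L(1) by auto
    show "\<epsilon> \<le> covol t M y" if "M \<in> insert L F" for M using that F(5) L(2) by auto
    show "covol t M y \<le> 1" if "M \<in> insert L F" for M using that F(6) L(3) by auto
  qed
qed

section \<open>The measure of points with short vectors\<close>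

text \<open>
  The \<open>l\<^sub>1\<close>-norm of \<open>t\<close> is twice the sum of the \<open>t $ Some j\<close>. Only some of these need to grow with \<open>t\<close>, which is
  why the lower bound for covolumes relies on a single large one.
\<close>

lemma a_plus_large_coordinate:
  fixes t :: "real^('n::finite option)"
  assumes t: "t \<in> a_plus" and large: "2 * real CARD('n) * B < infnorm t"
  obtains j where "B < t $ Some j"
proof (rule ccontr)
  assume "\<not> thesis"
  then have le: "t $ Some j \<le> B" for j using that not_less by blast
  have "infnorm t \<le> norm t" by (rule infnorm_le_norm)
  also have "\<dots> \<le> (\<Sum>s\<in>UNIV. \<bar>t $ s\<bar>)" by (rule norm_le_l1_cart)
  also have "\<dots> = 2 * (\<Sum>j\<in>UNIV. t $ Some j)"
    using t by (simp add: sum_option a_plus_def abs_of_pos)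
  also have "\<dots> \<le> 2 * (real CARD('n) * B)" using sum_bounded_above[of UNIV "\<lambda>j. t $ Some j" B] le by simp
  finally show False using large by simp
qed

definition has_short_vector :: "real \<Rightarrow> real^('n option) \<Rightarrow> real^'n \<Rightarrow> bool" where
  "has_short_vector \<epsilon> t y \<longleftrightarrow>
    (\<exists>v\<in>int_vecs. v \<noteq> 0 \<and> (\<forall>s. \<bar>sheared_coord y v s\<bar> \<le> \<epsilon> * weight t s))"

text \<open>
  Points that are marked for the threshold \<open>2 * k * \<epsilon>\<close> have no vectors shorter than \<open>\<epsilon>\<close>; the factor \<open>2\<close> leaves
  room for non-strict inequalities. How large \<open>t\<close> must be depends on the ball, through the constant \<open>\<kappa>\<close> of
  nonplanarity, but the proportion of the exceptional set does not.
\<close>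

lemma short_vector_measure:
  fixes \<nu> :: "'a::euclidean_space measure" and f :: "'a \<Rightarrow> real^'n::finite"
  defines "k \<equiv> CARD('n option)"
  assumes borel: "sets \<nu> = sets borel" and pos: "C > 0" "\<alpha> > 0" "D > 0"
    and cont: "continuous_on V f" and Fed: "Federer_on D \<nu> V"
    and good: "good_on C \<alpha> \<nu> V f" and nonpl: "nonplanar_on \<nu> V f"
    and x: "x \<in> msupp \<nu>" "0 < r" "ball x (7 ^ k * r) \<subseteq> V"
    and \<epsilon>: "0 < \<epsilon>" "2 * real k * \<epsilon> \<le> 1"
  shows "\<exists>t0. \<forall>t\<in>a_plus. t0 < infnorm t \<longrightarrow> (\<exists>N\<in>sets borel.
      {z \<in> ball x r \<inter> msupp \<nu>. has_short_vector \<epsilon> t (f z)} \<subseteq> N \<and>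
      emeasure \<nu> N \<le> ennreal (nondiv_const C D k * (2 * real k * \<epsilon>) powr \<alpha>) * emeasure \<nu> (ball x r))"
proof -
  let ?A = "ball x r \<inter> msupp \<nu>"
  have "r \<le> 7 ^ k * r" using x(2) by simp
  then have BV: "ball x r \<subseteq> V" using x(3) subset_ball by blast
  have indep: "c0 = 0 \<and> (\<forall>i. c $ i = 0)" if "\<forall>y\<in>?A. c0 + (\<Sum>i\<in>UNIV. c $ i * f y $ i) = 0" for c0 c
    using nonpl x(1,2) BV that unfolding nonplanar_on_def by blast
  obtain \<kappa> where \<kappa>: "\<kappa> > 0"
    "\<And>c0 c. (\<exists>j. 1 \<le> \<bar>c $ j\<bar>) \<Longrightarrow> \<exists>y\<in>?A. \<kappa> \<le> \<bar>c0 + (\<Sum>i\<in>UNIV. c $ i * f y $ i)\<bar>"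
    using uniform_nonplanarity[OF indep] by blast
  let ?P = "{L :: (real^'n option) set. rational_subspace L \<and> L \<noteq> {0}}"
  have "\<exists>N\<in>sets borel.
      {z \<in> ?A. has_short_vector \<epsilon> t (f z)} \<subseteq> N \<and>
      emeasure \<nu> N \<le> ennreal (nondiv_const C D k * (2 * real k * \<epsilon>) powr \<alpha>) * emeasure \<nu> (ball x r)"
    if t: "t \<in> a_plus" and large: "2 * real CARD('n) * (- ln \<kappa>) < infnorm t" for t
  proof -
    obtain j where j: "- ln \<kappa> < t $ Some j" using a_plus_large_coordinate[OF t large] .
    have "1 = exp (- ln \<kappa>) * \<kappa>" using \<kappa>(1) by (simp add: exp_minus)
    also have "\<dots> \<le> exp (t $ Some j) * \<kappa>" using j \<kappa>(1) by (intro mult_right_mono) auto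
    finally have big: "1 \<le> exp (t $ Some j) * \<kappa>" .
    have sup: "1 \<le> supnorm \<nu> (ball x r) (\<lambda>z. covol t L (f z))" if L: "L \<in> ?P" for L
    proof -
      have "x \<in> ?A" using x by simp
      then have ne: "?A \<noteq> {}" by blast
      have L': "rational_subspace L" "L \<noteq> {0}" using L by blast+
      obtain z where z: "z \<in> ?A" "1 \<le> covol t L (f z)"
        using covol_lower_bound[OF L' t ne \<kappa>(2) big] by blast
      have "1 \<le> ennreal \<bar>covol t L (f z)\<bar>" using z(2) by simp
      also have "\<dots> \<le> supnorm \<nu> (ball x r) (\<lambda>z. covol t L (f z))"
        using z(1) by (intro supnorm_ge[where g = "\<lambda>z. covol t L (f z)"]) auto
      finally show ?thesis .
    qed
    have "\<exists>N\<in>sets borel.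
      {z \<in> ?A. \<not> marked comparable (2 * real k * \<epsilon>) (\<lambda>L. covol t L (f z)) ?P} \<subseteq> N \<and>
      emeasure \<nu> N \<le> ennreal (nondiv_const C D k * (2 * real k * \<epsilon>) powr \<alpha>) * emeasure \<nu> (ball x r)"
    proof (rule quantitative_nondivergence[where \<psi> = "\<lambda>L z. covol t L (f z)" and V = V,
          OF borel Fed pos])
      show "symp (comparable :: (real^'n option) set \<Rightarrow> _)"
        "irreflp (comparable :: (real^'n option) set \<Rightarrow> _)"
        unfolding symp_def irreflp_def comparable_def by blast+
      show "cliques_le comparable k ?P" unfolding k_def by (rule cliques_le_rational_subspaces)
      show "0 < 2 * real k * \<epsilon>" using \<epsilon>(1) by (simp add: k_def)
    qed (rule good_covol[OF borel pos(1,2) cont good] covol_nonneg x sup | assumption)+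
    then obtain N where N: "N \<in> sets borel"
      "{z \<in> ?A. \<not> marked comparable (2 * real k * \<epsilon>) (\<lambda>L. covol t L (f z)) ?P} \<subseteq> N"
      "emeasure \<nu> N \<le> ennreal (nondiv_const C D k * (2 * real k * \<epsilon>) powr \<alpha>) * emeasure \<nu> (ball x r)"
      by blast
    have "{z \<in> ?A. has_short_vector \<epsilon> t (f z)} \<subseteq> N"
    proof (intro subsetI)
      fix z assume z: "z \<in> {z \<in> ?A. has_short_vector \<epsilon> t (f z)}"
      show "z \<in> N"
      proof (rule ccontr)
        assume "z \<notin> N"
        then have mk: "marked comparable (2 * real k * \<epsilon>) (\<lambda>L. covol t L (f z)) ?P" using N(2) z by blast
        obtain v where v: "v \<in> int_vecs" "v \<noteq> 0" "\<And>s. \<bar>sheared_coord (f z) v s\<bar> \<le> \<epsilon> * weight t s"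
          using z by (auto simp: has_short_vector_def)
        have "2 * real k * \<epsilon> \<le> real CARD('n option) * \<epsilon>"
          by (rule marked_imp_no_short_vector[where F = "{}", OF mk _ _ _ _ _ _ t \<epsilon>(2) v(1,2) _ v(3)])
            (use \<epsilon>(1) in simp_all)
        then show False using \<epsilon>(1) by (simp add: k_def)
      qed
    qed
    then show ?thesis using N by blast
  qed
  then show ?thesis by (intro exI[of _ "2 * real CARD('n) * (- ln \<kappa>)"] ballI impI)
qed

section \<open>Sets without density points\<close>

lemma emeasure_compact_finite:
  assumes \<nu>: "radon_measure \<nu>" and "compact K"
  shows "emeasure \<nu> K < \<infinity>"
proof -
  have borel: "sets \<nu> = sets borel" using \<nu> by (simp add: radon_measure_def)
  have "\<forall>x\<in>K. \<exists>V. open V \<and> x \<in> V \<and> emeasure \<nu> V < \<infinity>" using \<nu> by (simp add: radon_measure_def)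
  then obtain V where V: "\<And>x. x \<in> K \<Longrightarrow> open (V x) \<and> x \<in> V x \<and> emeasure \<nu> (V x) < \<infinity>" by metis
  obtain F where F: "F \<subseteq> K" "finite F" "K \<subseteq> (\<Union>x\<in>F. V x)"
    by (rule compactE_image[OF \<open>compact K\<close>, of K V]) (use V in auto)
  have Vs: "V ` F \<subseteq> sets \<nu>" using V F(1) borel by auto
  have "emeasure \<nu> K \<le> emeasure \<nu> (\<Union>x\<in>F. V x)"
    using F Vs by (intro emeasure_mono) auto
  also have "\<dots> \<le> (\<Sum>x\<in>F. emeasure \<nu> (V x))"
    using F Vs by (intro emeasure_subadditive_finite) auto
  also have "\<dots> < \<infinity>" using V F by (auto simp: less_top)
  finally show ?thesis .
qed

text \<open>
  A substitute for Lebesgue's density theorem. If \<open>A\<close> had positive measure, it would contain a compact set \<open>K\<close>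
  of positive measure that nearly fills an open set \<open>W\<close>. Disjoint balls inside \<open>W\<close> whose fivefold enlargements
  cover \<open>K\<close> carry at least a fixed proportion of the measure of \<open>K\<close>, and at least half of the measure of each
  of them lies in \<open>W - K\<close>, which contradicts the choice of \<open>W\<close>.
\<close>

lemma null_of_no_density:
  fixes \<nu> :: "'a::euclidean_space measure"
  assumes \<nu>: "radon_measure \<nu>" and D: "D > 0" and A: "A \<in> sets borel"
    and thin: "\<And>x. x \<in> A \<Longrightarrow> x \<in> msupp \<nu> \<and> (\<exists>\<rho>>0. Federer_on D \<nu> (ball x \<rho>) \<and>
      (\<forall>r. 0 < r \<and> r < \<rho> \<longrightarrow> emeasure \<nu> (A \<inter> ball x r) \<le> ennreal (1/2) * emeasure \<nu> (ball x r)))"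
  shows "emeasure \<nu> A = 0"
proof (rule ccontr)
  assume "emeasure \<nu> A \<noteq> 0"
  have borel: "sets \<nu> = sets borel" using \<nu> by (simp add: radon_measure_def)
  have "emeasure \<nu> A = (SUP K\<in>{K. K \<subseteq> A \<and> compact K}. emeasure \<nu> K)"
    using \<nu> A unfolding radon_measure_def by blast
  then have "0 < (SUP K\<in>{K. K \<subseteq> A \<and> compact K}. emeasure \<nu> K)"
    using \<open>emeasure \<nu> A \<noteq> 0\<close> by (simp add: zero_less_iff_neq_zero)
  then obtain K where K: "K \<subseteq> A" "compact K" "0 < emeasure \<nu> K" by (auto simp: less_SUP_iff)
  have Km: "K \<in> sets \<nu>" using K(2) borel by (auto intro: borel_compact)
  obtain m where m: "emeasure \<nu> K = ennreal m" "0 < m"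
    using K(3) emeasure_compact_finite[OF \<nu> K(2)] by (cases "emeasure \<nu> K") auto
  \<comment> \<open>The covering argument gives \<open>m \<le> 2 * D\<^sup>2 * c\<close>, which this value of \<open>c\<close> turns into \<open>m \<le> m / 2\<close>.\<close>
  define c where "c = m / (4 * D\<^sup>2)"
  have c: "0 < c" using m D by (simp add: c_def)
  have "emeasure \<nu> K = (INF W\<in>{W. K \<subseteq> W \<and> open W}. emeasure \<nu> W)"
    using \<nu> Km borel unfolding radon_measure_def by blast
  moreover have "emeasure \<nu> K < ennreal (m + c)" using m c by (simp add: ennreal_less_iff)
  ultimately have "(INF W\<in>{W. K \<subseteq> W \<and> open W}. emeasure \<nu> W) < ennreal (m + c)" by simp
  then obtain W where W: "K \<subseteq> W" "open W" "emeasure \<nu> W < ennreal (m + c)" by (auto simp: INF_less_iff)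
  have Wm: "W \<in> sets \<nu>" using W borel by auto
  have Wfin: "emeasure \<nu> W < \<infinity>" using W(3) ennreal_less_top less_trans infinity_ennreal_def by metis
  have "\<exists>r>0. r \<le> 1 \<and> ball x r \<subseteq> W \<and> Federer_on D \<nu> (ball x (9 * r)) \<and>
      emeasure \<nu> (A \<inter> ball x r) \<le> ennreal (1/2) * emeasure \<nu> (ball x r)" if "x \<in> K" for x
  proof -
    have "x \<in> A" using that K(1) by blast
    from thin[OF this] obtain \<rho> where \<rho>: "\<rho> > 0" "Federer_on D \<nu> (ball x \<rho>)"
      "\<forall>r. 0 < r \<and> r < \<rho> \<longrightarrow> emeasure \<nu> (A \<inter> ball x r) \<le> ennreal (1/2) * emeasure \<nu> (ball x r)"
      by blast
    have "x \<in> W" using that W(1) by blast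
    then obtain s where s: "s > 0" "ball x s \<subseteq> W" by (rule openE[OF W(2)])
    \<comment> \<open>The factor \<open>9\<close> leaves room for two triplings, which cover the fivefold enlargement.\<close>
    define r where "r = min (min 1 s) (\<rho> / 9)"
    have r: "0 < r" "r \<le> 1" "r \<le> s" "9 * r \<le> \<rho>" "r < \<rho>" using \<rho>(1) s(1) by (auto simp: r_def)
    have "ball x (9 * r) \<subseteq> ball x \<rho>" by (rule subset_ball) (rule r)
    then have "Federer_on D \<nu> (ball x (9 * r))" using \<rho>(2) unfolding Federer_on_def by blast
    moreover have "ball x r \<subseteq> W" using s(2) subset_ball[OF r(3)] by blast
    ultimately show ?thesis using r \<rho>(3) by blast
  qed
  then obtain r where r: "\<And>x. x \<in> K \<Longrightarrow> 0 < r x \<and> r x \<le> 1 \<and> ball x (r x) \<subseteq> W \<and>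
      Federer_on D \<nu> (ball x (9 * r x)) \<and>
      emeasure \<nu> (A \<inter> ball x (r x)) \<le> ennreal (1/2) * emeasure \<nu> (ball x (r x))"
    by metis
  obtain I where I: "countable I" "I \<subseteq> K"
    and disj: "pairwise (\<lambda>x y. disjnt (ball x (r x)) (ball y (r y))) I"
    and cover: "K \<subseteq> (\<Union>x\<in>I. ball x (5 * r x))"
  proof (rule Vitali_covering_lemma_balls[where S = K and K = K and a = "\<lambda>y. y" and r = r and B = 1])
    show "K \<subseteq> (\<Union>x\<in>K. ball x (r x))" using r by force
    show "0 < r x \<and> r x \<le> 1" if "x \<in> K" for x using r[OF that] by auto
  qed (auto intro: that)
  have ball_le: "emeasure \<nu> (ball x (5 * r x)) \<le> ennreal (2 * D\<^sup>2) * emeasure \<nu> (ball x (r x) - K)"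
    if "x \<in> I" for x
  proof -
    have x: "x \<in> K" "x \<in> msupp \<nu>" using that I(2) K(1) thin by auto
    let ?B = "ball x (r x)"
    have "emeasure \<nu> ?B \<le> emeasure \<nu> W" using r[OF x(1)] Wm by (intro emeasure_mono) auto
    then obtain b where b: "emeasure \<nu> ?B = ennreal b" "0 \<le> b"
      using Wfin by (cases "emeasure \<nu> ?B") (auto simp: top_unique)
    have "emeasure \<nu> (?B - K) \<le> emeasure \<nu> ?B" using borel by (intro emeasure_mono) auto
    then obtain d where d: "emeasure \<nu> (?B - K) = ennreal d" "0 \<le> d"
      using b by (cases "emeasure \<nu> (?B - K)") (auto simp: top_unique)
    have "emeasure \<nu> ?B = emeasure \<nu> (K \<inter> ?B) + emeasure \<nu> (?B - K)"
      using Km borel by (subst plus_emeasure) (auto intro!: arg_cong[where f = "emeasure \<nu>"])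
    also have "emeasure \<nu> (K \<inter> ?B) \<le> emeasure \<nu> (A \<inter> ?B)"
      using K(1) A borel by (intro emeasure_mono) auto
    also have "\<dots> \<le> ennreal (1/2) * emeasure \<nu> ?B" using r[OF x(1)] by blast
    finally have "ennreal b \<le> ennreal (1/2) * ennreal b + ennreal d"
      unfolding b d by (simp add: add_right_mono)
    also have "\<dots> = ennreal (1/2 * b + d)"
    proof -
      have nn: "0 \<le> (1/2 :: real)" "0 \<le> 1/2 * b" using b(2) by auto
      show ?thesis by (simp only: ennreal_plus[OF nn(2) d(2)] ennreal_mult[OF nn(1) b(2)])
    qed
    finally have "ennreal b \<le> ennreal (1/2 * b + d)" .
    moreover have "0 \<le> 1/2 * b + d" using b(2) d(2) by simp
    ultimately have "b \<le> 1/2 * b + d" using ennreal_le_iff by blast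
    then have "b \<le> 2 * d" by linarith
    then have half: "emeasure \<nu> ?B \<le> ennreal 2 * emeasure \<nu> (?B - K)"
      unfolding b d using d(2) by (simp add: ennreal_mult[symmetric] ennreal_leI del: ennreal_numeral)
    have "emeasure \<nu> (ball x (5 * r x)) \<le> emeasure \<nu> (ball x (3 ^ 2 * r x))"
      using r[OF x(1)] borel by (intro emeasure_mono subset_ball) auto
    also have "\<dots> \<le> ennreal (D\<^sup>2) * emeasure \<nu> ?B"
      using r[OF x(1)] by (intro Federer_on_ball_power[OF _ D x(2)]) auto
    also have "\<dots> \<le> ennreal (D\<^sup>2) * (ennreal 2 * emeasure \<nu> (?B - K))"
      by (intro mult_left_mono half) simp
    also have "\<dots> = ennreal (2 * D\<^sup>2) * emeasure \<nu> (?B - K)"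
      by (subst mult.assoc[symmetric], subst ennreal_mult[symmetric]) (auto simp: mult.commute)
    finally show ?thesis .
  qed
  have "emeasure \<nu> K \<le> emeasure \<nu> (\<Union>x\<in>I. ball x (5 * r x))"
    using cover I(1) borel by (intro emeasure_mono) auto
  also have "\<dots> \<le> ennreal (2 * D\<^sup>2) * emeasure \<nu> (\<Union>x\<in>I. ball x (r x) - K)"
  proof (rule emeasure_UN_le_disjoint_UN[OF I(1)])
    show "pairwise (\<lambda>x y. disjnt (ball x (r x) - K) (ball y (r y) - K)) I"
      using disj unfolding pairwise_def disjnt_def by blast
  qed (use Km borel ball_le in auto)
  also have "\<dots> \<le> ennreal (2 * D\<^sup>2) * emeasure \<nu> (W - K)"
    using r I(2) Wm Km by (intro mult_left_mono emeasure_mono) force+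
  also have "emeasure \<nu> (W - K) = emeasure \<nu> W - emeasure \<nu> K"
    using m(1) Km Wm W(1) by (intro emeasure_Diff) auto
  also have "\<dots> \<le> ennreal (m + c) - ennreal m"
    using W(3) m(1) by (simp add: ennreal_minus_mono less_imp_le)
  also have "\<dots> = ennreal c" using m c by (simp add: ennreal_minus)
  finally have "ennreal m \<le> ennreal (2 * D\<^sup>2) * ennreal c"
    using m(1) by (simp add: mult_left_mono)
  also have "\<dots> = ennreal (m / 2)" using D c by (simp add: ennreal_mult[symmetric] c_def)
  finally show False using m(2) by (simp add: ennreal_le_iff)
qed

text \<open>
  By the Lindeloef property, the union of all open null sets is a countable union of such sets.
\<close>

lemma null_sets_Compl_msupp:
  fixes \<nu> :: "'a::euclidean_space measure"
  assumes borel: "sets \<nu> = sets borel"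
  shows "- msupp \<nu> \<in> null_sets \<nu>"
proof -
  let ?F = "{V. open V \<and> emeasure \<nu> V = 0}"
  have eq: "- msupp \<nu> = \<Union>?F" by (auto simp: msupp_def zero_less_iff_neq_zero)
  obtain F where F: "F \<subseteq> ?F" "countable F" "\<Union>F = \<Union>?F" by (rule Lindelof[of ?F]) blast+
  have "\<Union>F \<in> null_sets \<nu>"
  proof -
    have "V \<in> null_sets \<nu>" if "V \<in> F" for V
      using F(1) that borel by (auto intro!: null_setsI)
    then show ?thesis using null_sets_UN'[of F "\<lambda>V. V" \<nu>] F(2) by simp
  qed
  then show ?thesis unfolding eq F(3) .
qed

section \<open>Improvable points form a null set\<close>

definition dirichlet_solvable :: "real \<Rightarrow> real^('n::finite option) \<Rightarrow> real^'n \<Rightarrow> bool" where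
  "dirichlet_solvable \<epsilon> t y \<longleftrightarrow> (\<exists>(q::int ^ 'n) (p::int). q \<noteq> 0 \<and>
     \<bar>(\<Sum>j\<in>UNIV. y $ j * of_int (q $ j)) - of_int p\<bar> < \<epsilon> * exp (- (t $ None)) \<and>
     (\<forall>j. \<bar>of_int (q $ j)\<bar> < \<epsilon> * exp (t $ Some j)))"

text \<open>
  The lattice point is \<open>(- p, q)\<close>.
\<close>

lemma dirichlet_solvable_imp_short_vector:
  assumes "dirichlet_solvable \<epsilon> t y"
  shows "has_short_vector \<epsilon> t y"
proof -
  obtain q :: "int^'a" and p :: int where qp: "q \<noteq> 0"
    "\<bar>(\<Sum>j\<in>UNIV. y $ j * of_int (q $ j)) - of_int p\<bar> < \<epsilon> * exp (- (t $ None))"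
    "\<And>j. \<bar>of_int (q $ j)\<bar> < \<epsilon> * exp (t $ Some j)"
    using assms by (auto simp: dirichlet_solvable_def)
  define v :: "real^('a option)" where
    "v = (\<chi> s. case s of None \<Rightarrow> - of_int p | Some j \<Rightarrow> of_int (q $ j))"
  have "v \<in> int_vecs" by (auto simp: int_vecs_def v_def split: option.split)
  moreover have "v \<noteq> 0"
  proof
    assume "v = 0"
    then have "v $ Some j = 0" for j by simp
    then have "q = 0" by (simp add: v_def vec_eq_iff)
    then show False using qp(1) by simp
  qed
  moreover have "\<bar>sheared_coord y v s\<bar> \<le> \<epsilon> * weight t s" for s
    using qp(2,3) by (cases s) (auto simp: sheared_coord_def weight_def v_def less_imp_le)
  ultimately show ?thesis unfolding has_short_vector_def by blast
qed

lemma open_dirichlet_solvable: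
  assumes "open U" "continuous_on U f"
  shows "open {x \<in> U. dirichlet_solvable \<epsilon> t (f x)}"
proof -
  let ?E = "\<lambda>(q, p). {x \<in> U. \<bar>(\<Sum>j\<in>UNIV. f x $ j * of_int (q $ j)) - of_int p\<bar> < \<epsilon> * exp (- (t $ None))}"
  have "open (?E qp)" for qp
    using assms by (cases qp) (auto intro!: open_sublevel_within continuous_intros)
  then have "open (\<Union>qp\<in>{(q, p). q \<noteq> 0 \<and> (\<forall>j. \<bar>of_int (q $ j)\<bar> < \<epsilon> * exp (t $ Some j))}. ?E qp)"
    by blast
  also have "(\<Union>qp\<in>{(q, p). q \<noteq> 0 \<and> (\<forall>j. \<bar>of_int (q $ j)\<bar> < \<epsilon> * exp (t $ Some j))}. ?E qp)
      = {x \<in> U. dirichlet_solvable \<epsilon> t (f x)}"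
    by (auto simp: dirichlet_solvable_def)
  finally show ?thesis .
qed

lemma unbounded_sequence:
  fixes T :: "'a::euclidean_space set"
  assumes "\<not> bounded T"
  obtains \<tau> :: "nat \<Rightarrow> 'a" where "\<And>m. \<tau> m \<in> T" "\<And>m. real m < infnorm (\<tau> m)"
proof -
  have "\<exists>t\<in>T. real m < infnorm t" for m
  proof (rule ccontr)
    assume "\<not> ?thesis"
    then have "norm t \<le> sqrt DIM('a) * real m" if "t \<in> T" for t
      using that norm_le_infnorm[of t] by (meson mult_left_mono not_less order_trans real_sqrt_ge_zero of_nat_0_le_iff)
    then show False using assms boundedI by blast
  qed
  then obtain \<tau> where "\<And>m. \<tau> m \<in> T \<and> real m < infnorm (\<tau> m)" by metis
  then show thesis using that by blast
qed

definition regular_point ::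
  "real \<Rightarrow> real \<Rightarrow> real \<Rightarrow> 'a::euclidean_space measure \<Rightarrow> 'a set \<Rightarrow> ('a \<Rightarrow> real^'n) \<Rightarrow> 'a \<Rightarrow> bool" where
  "regular_point C \<alpha> D \<nu> U f x \<longleftrightarrow> x \<in> msupp \<nu> \<and> (\<exists>\<rho>>0. ball x \<rho> \<subseteq> U \<and>
     Federer_on D \<nu> (ball x \<rho>) \<and> good_on C \<alpha> \<nu> (ball x \<rho>) f \<and> nonplanar_on \<nu> (ball x \<rho>) f)"

lemma AE_regular_point:
  fixes \<nu> :: "'a::euclidean_space measure"
  assumes borel: "sets \<nu> = sets borel"
    and "Federer D \<nu>" "good C \<alpha> \<nu> U f" "nonplanar \<nu> U f"
  shows "AE x in \<nu>. x \<in> U \<longrightarrow> regular_point C \<alpha> D \<nu> U f x"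
proof -
  have "AE x in \<nu>. x \<in> msupp \<nu>"
    using AE_not_in[OF null_sets_Compl_msupp[OF borel]] by auto
  moreover have "AE x in \<nu>. \<exists>V. open V \<and> x \<in> V \<and> Federer_on D \<nu> V"
    using assms(2) by (simp add: Federer_def)
  moreover have "AE x in \<nu>. x \<in> U \<longrightarrow> (\<exists>V\<subseteq>U. open V \<and> x \<in> V \<and> good_on C \<alpha> \<nu> V f)"
    using assms(3) by (simp add: good_def)
  moreover have "AE x in \<nu>. x \<in> U \<longrightarrow> (\<exists>V\<subseteq>U. open V \<and> x \<in> V \<and> nonplanar_on \<nu> V f)"
    using assms(4) by (simp add: nonplanar_def)
  ultimately show ?thesis
  proof eventually_elim
    case (elim x)
    show ?case
    proof
      assume "x \<in> U"
      then obtain V1 V2 V3 where V: "open V1" "x \<in> V1" "Federer_on D \<nu> V1"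
        "V2 \<subseteq> U" "open V2" "x \<in> V2" "good_on C \<alpha> \<nu> V2 f"
        "open V3" "x \<in> V3" "nonplanar_on \<nu> V3 f"
        using elim by blast
      have "open (V1 \<inter> V2 \<inter> V3)" "x \<in> V1 \<inter> V2 \<inter> V3" using V by auto
      then obtain \<rho> where \<rho>: "\<rho> > 0" "ball x \<rho> \<subseteq> V1 \<inter> V2 \<inter> V3" by (rule openE)
      then have sub: "ball x \<rho> \<subseteq> V1" "ball x \<rho> \<subseteq> V2" "ball x \<rho> \<subseteq> V3" by auto
      have "Federer_on D \<nu> (ball x \<rho>)"
        using V(3) order_trans[OF _ sub(1)] unfolding Federer_on_def by blast
      moreover have "good_on C \<alpha> \<nu> (ball x \<rho>) f"
        using V(7) order_trans[OF _ sub(2)] unfolding good_on_def good_fun_on_def by blast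
      moreover have "nonplanar_on \<nu> (ball x \<rho>) f"
        using V(10) order_trans[OF _ sub(3)] unfolding nonplanar_on_def by blast
      ultimately show "regular_point C \<alpha> D \<nu> U f x"
        unfolding regular_point_def using elim(1) \<rho>(1) sub(2) V(4) by blast
    qed
  qed
qed

text \<open>
  At almost every point of \<open>U\<close> all hypotheses hold on a common ball. On every sufficiently small concentric
  ball, choose a single index \<open>j \<ge> m\<close> for which \<open>\<tau> j\<close> is large enough; the measure estimate for this \<open>\<tau> j\<close>
  shows that the set fills at most half of the ball.
\<close>

lemma eventually_solvable_null:
  fixes \<nu> :: "'a::euclidean_space measure" and f :: "'a \<Rightarrow> real^'n::finite" and \<epsilon> C \<alpha> D :: real
  defines "k \<equiv> CARD('n option)"
  assumes \<nu>: "radon_measure \<nu>" and U: "open U" and cont: "continuous_on U f" and pos: "C > 0" "\<alpha> > 0" "D > 0"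
    and reg: "AE x in \<nu>. x \<in> U \<longrightarrow> regular_point C \<alpha> D \<nu> U f x"
    and \<epsilon>: "0 < \<epsilon>" "2 * real k * \<epsilon> \<le> 1" "nondiv_const C D k * (2 * real k * \<epsilon>) powr \<alpha> \<le> 1/2"
    and \<tau>: "\<And>j. \<tau> j \<in> a_plus" "\<And>j. real j < infnorm (\<tau> j)"
  shows "{x \<in> U. \<forall>j\<ge>m. dirichlet_solvable \<epsilon> (\<tau> j) (f x)} \<in> null_sets \<nu>" (is "?A \<in> _")
proof -
  have borel: "sets \<nu> = sets borel" using \<nu> by (simp add: radon_measure_def)
  have space: "space \<nu> = UNIV" using sets_eq_imp_space_eq[OF borel] by simp
  define E where "E = ?A"
  have "E = (\<Inter>j\<in>{m..}. {x \<in> U. dirichlet_solvable \<epsilon> (\<tau> j) (f x)})"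
    by (auto simp: E_def)
  also have "\<dots> \<in> sets borel"
    using open_dirichlet_solvable[OF U cont] by (intro sets.countable_INT') auto
  finally have A: "E \<in> sets borel" .
  obtain N where N: "{x. \<not> (x \<in> U \<longrightarrow> regular_point C \<alpha> D \<nu> U f x)} \<subseteq> N" "N \<in> null_sets \<nu>"
    using AE_E[OF reg, unfolded space] by (metis (no_types, lifting) null_setsI UNIV_I Collect_cong)
  have "emeasure \<nu> (E - N) = 0"
  proof (rule null_of_no_density[OF \<nu> pos(3)])
    show "E - N \<in> sets borel" using A null_setsD2[OF N(2)] borel by (simp add: sets.Diff)
    fix x assume x: "x \<in> E - N"
    then have "x \<in> U" "x \<notin> N" by (auto simp: E_def)
    then have "regular_point C \<alpha> D \<nu> U f x" using N(1) by blast
    then obtain \<rho> where \<rho>: "x \<in> msupp \<nu>" "\<rho> > 0" "ball x \<rho> \<subseteq> U" "Federer_on D \<nu> (ball x \<rho>)"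
      "good_on C \<alpha> \<nu> (ball x \<rho>) f" "nonplanar_on \<nu> (ball x \<rho>) f"
      unfolding regular_point_def by blast
    have "emeasure \<nu> ((E - N) \<inter> ball x r) \<le> ennreal (1/2) * emeasure \<nu> (ball x r)"
      if r: "0 < r" "r < \<rho> / 7 ^ k" for r
    proof -
      have "7 ^ k * r \<le> \<rho>" using r(2) by (simp add: pos_less_divide_eq mult.commute less_imp_le)
      then have "ball x (7 ^ k * r) \<subseteq> ball x \<rho>" by (rule subset_ball)
      then obtain t0 where t0: "\<And>t. t \<in> a_plus \<Longrightarrow> t0 < infnorm t \<Longrightarrow> (\<exists>N\<in>sets borel.
          {z \<in> ball x r \<inter> msupp \<nu>. has_short_vector \<epsilon> t (f z)} \<subseteq> N \<and>
          emeasure \<nu> N \<le> ennreal (nondiv_const C D k * (2 * real k * \<epsilon>) powr \<alpha>) * emeasure \<nu> (ball x r))"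
        using short_vector_measure[OF borel pos continuous_on_subset[OF cont \<rho>(3)] \<rho>(4,5,6,1) r(1) _ \<epsilon>(1),
            folded k_def] \<epsilon>(2) by blast
      define j where "j = max m (nat \<lceil>t0\<rceil>)"
      have "t0 \<le> real j" by (simp add: j_def) linarith
      then have "t0 < infnorm (\<tau> j)" using \<tau>(2)[of j] by linarith
      from t0[OF \<tau>(1) this] obtain N' where N': "N' \<in> sets borel"
          "{z \<in> ball x r \<inter> msupp \<nu>. has_short_vector \<epsilon> (\<tau> j) (f z)} \<subseteq> N'"
          "emeasure \<nu> N' \<le> ennreal (nondiv_const C D k * (2 * real k * \<epsilon>) powr \<alpha>) * emeasure \<nu> (ball x r)"
        by blast
      have "(E - N) \<inter> ball x r \<subseteq> N' \<union> - msupp \<nu>"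
      proof
        fix z assume z: "z \<in> (E - N) \<inter> ball x r"
        then have "dirichlet_solvable \<epsilon> (\<tau> j) (f z)" by (auto simp: E_def j_def)
        then have "has_short_vector \<epsilon> (\<tau> j) (f z)" by (rule dirichlet_solvable_imp_short_vector)
        then show "z \<in> N' \<union> - msupp \<nu>" using N'(2) z by blast
      qed
      moreover have supp: "- msupp \<nu> \<in> null_sets \<nu>" by (rule null_sets_Compl_msupp[OF borel])
      ultimately have "emeasure \<nu> ((E - N) \<inter> ball x r) \<le> emeasure \<nu> (N' \<union> - msupp \<nu>)"
        using N'(1) borel by (intro emeasure_mono) auto
      also have "\<dots> = emeasure \<nu> N'" using N'(1) borel supp by (intro emeasure_Un_null_set) auto
      also have "\<dots> \<le> ennreal (nondiv_const C D k * (2 * real k * \<epsilon>) powr \<alpha>) * emeasure \<nu> (ball x r)"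
        by (rule N'(3))
      also have "\<dots> \<le> ennreal (1/2) * emeasure \<nu> (ball x r)"
        by (intro mult_right_mono ennreal_leI \<epsilon>(3)) simp
      finally show ?thesis .
    qed
    moreover have "ball x (\<rho> / 7 ^ k) \<subseteq> ball x \<rho>"
      using \<rho>(2) by (intro subset_ball) (simp add: divide_le_eq)
    then have "Federer_on D \<nu> (ball x (\<rho> / 7 ^ k))" using \<rho>(4) unfolding Federer_on_def by blast
    ultimately show "x \<in> msupp \<nu> \<and> (\<exists>\<rho>>0. Federer_on D \<nu> (ball x \<rho>) \<and>
        (\<forall>r. 0 < r \<and> r < \<rho> \<longrightarrow> emeasure \<nu> ((E - N) \<inter> ball x r) \<le> ennreal (1/2) * emeasure \<nu> (ball x r)))"
      using \<rho>(1,2) by (intro conjI exI[of _ "\<rho> / 7 ^ k"]) auto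
  qed
  then have "emeasure \<nu> E = 0"
    using emeasure_Diff_null_set[OF N(2)] A borel by simp
  then have "E \<in> null_sets \<nu>" using A borel by (intro null_setsI) auto
  then show ?thesis by (simp only: E_def)
qed

theorem theorem1p5:
  fixes C \<alpha> D :: real
  assumes "C > 0" and "\<alpha> > 0" and "D > 0"
  shows "\<exists>\<epsilon>0::real. 0 < \<epsilon>0 \<and> \<epsilon>0 \<le> 1 \<and>
    (\<forall>(\<nu> :: (real ^ 'd) measure) (U :: (real ^ 'd) set) (f :: real ^ 'd \<Rightarrow> real ^ 'n).
       radon_measure \<nu> \<and> open U \<and> emeasure \<nu> U > 0 \<and> continuous_on U f \<and>
       Federer D \<nu> \<and> good C \<alpha> \<nu> U f \<and> nonplanar \<nu> U f \<longrightarrow>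
       (\<forall>\<epsilon>. 0 < \<epsilon> \<and> \<epsilon> < \<epsilon>0 \<longrightarrow>
          (\<forall>T :: (real ^ ('n option)) set. T \<subseteq> a_plus \<and> \<not> bounded T \<longrightarrow>
             {x \<in> U. f x \<in> DI \<epsilon> T} \<in> null_sets (completion \<nu>))))"
proof -
  define k where "k = CARD('n option)"
  define K where "K = nondiv_const C D k"
  \<comment> \<open>An upper bound for \<open>2 * k * \<epsilon>\<close> that makes the proportion of exceptional points at most one half.\<close>
  define \<delta> where "\<delta> = min 1 ((1 / (2 * (K + 1))) powr (1 / \<alpha>))"
  have K: "0 \<le> K" unfolding K_def by (rule nondiv_const_nonneg[OF assms(1,3)])
  have k: "1 \<le> real k" by (simp add: k_def)
  have \<delta>: "0 < \<delta>" "\<delta> \<le> 1" using K by (auto simp: \<delta>_def)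
  show ?thesis
  proof (intro exI[of _ "\<delta> / (2 * real k)"] conjI allI impI)
    show "0 < \<delta> / (2 * real k)" using \<delta> k by simp
    show "\<delta> / (2 * real k) \<le> 1" using \<delta> k by (subst pos_divide_le_eq) auto
    fix \<nu> :: "(real ^ 'd) measure" and U :: "(real ^ 'd) set" and f :: "real ^ 'd \<Rightarrow> real ^ 'n"
      and \<epsilon> :: real and T :: "(real ^ ('n option)) set"
    assume hyp: "radon_measure \<nu> \<and> open U \<and> emeasure \<nu> U > 0 \<and> continuous_on U f \<and>
       Federer D \<nu> \<and> good C \<alpha> \<nu> U f \<and> nonplanar \<nu> U f"
      and \<epsilon>: "0 < \<epsilon> \<and> \<epsilon> < \<delta> / (2 * real k)" and T: "T \<subseteq> a_plus \<and> \<not> bounded T"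
    have \<epsilon>\<delta>: "2 * real k * \<epsilon> \<le> \<delta>" using \<epsilon> k by (simp add: pos_less_divide_eq mult.commute less_imp_le)
    have "(2 * real k * \<epsilon>) powr \<alpha> \<le> \<delta> powr \<alpha>"
      using \<epsilon> \<epsilon>\<delta> assms(2) by (intro powr_mono2) auto
    also have "\<dots> \<le> ((1 / (2 * (K + 1))) powr (1 / \<alpha>)) powr \<alpha>"
      using \<delta>(1) assms(2) by (intro powr_mono2) (auto simp: \<delta>_def)
    also have "\<dots> = 1 / (2 * (K + 1))" using assms(2) K by (simp add: powr_powr)
    finally have "K * (2 * real k * \<epsilon>) powr \<alpha> \<le> K * (1 / (2 * (K + 1)))"
      by (rule mult_left_mono) (rule K)
    also have "\<dots> \<le> 1/2" using K by (simp add: divide_le_eq)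
    finally have half: "K * (2 * real k * \<epsilon>) powr \<alpha> \<le> 1/2" .
    obtain \<tau> where \<tau>: "\<And>m. \<tau> m \<in> T" "\<And>m. real m < infnorm (\<tau> m)"
      using unbounded_sequence[of T] T by blast
    have borel: "sets \<nu> = sets borel" using hyp by (simp add: radon_measure_def)
    have reg: "AE x in \<nu>. x \<in> U \<longrightarrow> regular_point C \<alpha> D \<nu> U f x"
      using hyp by (intro AE_regular_point borel) auto
    have "{x \<in> U. \<forall>j\<ge>m. dirichlet_solvable \<epsilon> (\<tau> j) (f x)} \<in> null_sets \<nu>" for m
    proof (rule eventually_solvable_null[where C = C and \<alpha> = \<alpha> and D = D])
      show "\<tau> j \<in> a_plus" for j using \<tau>(1) T by blast
    qed (use hyp assms reg \<epsilon> \<epsilon>\<delta> \<delta> half \<tau>(2) in \<open>auto simp: k_def K_def\<close>)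
    then have "(\<Union>m. {x \<in> U. \<forall>j\<ge>m. dirichlet_solvable \<epsilon> (\<tau> j) (f x)}) \<in> null_sets (completion \<nu>)"
      by (intro null_sets_completionI null_sets_UN) auto
    moreover have "{x \<in> U. f x \<in> DI \<epsilon> T} \<subseteq> (\<Union>m. {x \<in> U. \<forall>j\<ge>m. dirichlet_solvable \<epsilon> (\<tau> j) (f x)})"
    proof
      fix x assume x: "x \<in> {x \<in> U. f x \<in> DI \<epsilon> T}"
      then obtain t0 where t0: "\<And>t. t \<in> T \<Longrightarrow> t0 < infnorm t \<Longrightarrow> dirichlet_solvable \<epsilon> t (f x)"
        by (auto simp: DI_def dirichlet_solvable_def)
      have "dirichlet_solvable \<epsilon> (\<tau> j) (f x)" if "j \<ge> nat \<lceil>t0\<rceil>" for j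
      proof (rule t0[OF \<tau>(1)])
        have "t0 \<le> real j" using that by linarith
        then show "t0 < infnorm (\<tau> j)" using \<tau>(2)[of j] by linarith
      qed
      then show "x \<in> (\<Union>m. {x \<in> U. \<forall>j\<ge>m. dirichlet_solvable \<epsilon> (\<tau> j) (f x)})" using x by blast
    qed
    ultimately show "{x \<in> U. f x \<in> DI \<epsilon> T} \<in> null_sets (completion \<nu>)"
      by (rule null_sets_completion_subset[rotated])
  qed
qed

end
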